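(* Let $m\ge1$, $n\ge4$, and let $\mathbf r=(r_1,\dots,r_n)$ be positive real numbers. For $1\le i\le n-3$ and $1\le j\le m+1$, on the open subset of $\widetilde N_{\mathbf r}=\prod_k\mathcal O_{r_k}$ where $\lambda_{ij}$ is a simple eigenvalue of $A_i=e_1+\cdots+e_{i+1}$, the function $\lambda_{ij}$ is the Hamiltonian for the system $$\dot e_k=\begin{cases}\sqrt{-1}\,[E_j(A_i),e_k], & 1\le k\le i+1,\\ 0,& i+1<k\le n,\end{cases}$$ and its Hamiltonian flow $\phi_{ij}^t(\mathbf e)=\mathbf e(t)$ is given by $$e_k(t)=\begin{cases}\exp(\sqrt{-1}\,tE_j(A_i))\,e_k\,\exp(-\sqrt{-1}\,tE_j(A_i)), & 1\le k\le i+1,\\ e_k,& i+1<k\le n,\end{cases}$$ where $A_i$ is evaluated at the initial point $\mathbf e$.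
   Context: For a unit vector $w\in\mathbb C^{m+1}$, $w\otimes w^*$ is the projection $v\mapsto(v,w)w$; $\mathcal O_r=\{r\,w\otimes w^*:\|w\|=1\}\subset\mathcal H_{m+1}$ (Hermitian $(m+1)\times(m+1)$ matrices). $\lambda_{i1}\ge\cdots\ge\lambda_{i,m+1}$ are the eigenvalues of $A_i=e_1+\cdots+e_{i+1}$, viewed as functions of $\mathbf e$; $E_j(A_i)$ is the orthogonal (spectral) projection onto the $\lambda_{ij}$-eigenspace of $A_i$. Symplectic conventions: $\mathfrak u(m+1)$ and $\mathcal H_{m+1}$ are paired by $\langle\xi,X\rangle=\operatorname{Im}\operatorname{Tr}(\xi X)$. The gradient $\nabla f(X)\in\mathfrak u(m+1)$ of a function $f$ on $\mathcal H_{m+1}$ is defined by $\operatorname{Im}\operatorname{Tr}(\nabla f(X)Y)=\frac{d}{dt}|_{t=0}f(X+tY)$ for $Y\in\mathcal H_{m+1}$. Each orbit carries the Kostant–Kirillov form $\omega(X)([\xi,X],[\eta,X])=\operatorname{Im}\operatorname{Tr}(X[\xi,\eta])$, with bracket $\{f,g\}(X)=\operatorname{Im}\operatorname{Tr}(X[\nabla f,\nabla g])$ and Hamilton's equations $\dot X=[\nabla f(X),X]$. $\widetilde N_{\mathbf r}$ has the product symplectic structure. *)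

theory Defs
  imports
    "HOL-Analysis.Analysis"
    "HOL-Computational_Algebra.Computational_Algebra"
begin

text \<open>
  Complex square matrices are elements of \<^typ>\<open>complex^'d^'d\<close>. In the library \<open>*\<close>, \<open>^\<close> and
  hence anything derived from them act componentwise on this type, so the matrix product is
  always \<open>**\<close>, and powers and the exponential are defined here from \<open>**\<close>.
\<close>

definition smat :: "complex \<Rightarrow> complex^'d^'d \<Rightarrow> complex^'d^'d" (infixr "*\<^sub>m" 75) where
  "c *\<^sub>m A = map_matrix ((*) c) A"

definition comm :: "complex^'d^'d \<Rightarrow> complex^'d^'d \<Rightarrow> complex^'d^'d" where
  "comm A B = A ** B - B ** A"

definition adj :: "complex^'d^'d \<Rightarrow> complex^'d^'d" where
  "adj A = map_matrix cnj (transpose A)"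

definition Herm :: "(complex^'d^'d) set" where
  "Herm = {A. adj A = A}"

definition u_alg :: "(complex^'d^'d) set" where
  "u_alg = {A. adj A = - A}"

definition mpow :: "complex^'d^'d \<Rightarrow> nat \<Rightarrow> complex^'d^'d" where
  "mpow A k = (((**) A) ^^ k) (mat 1)"

definition mexp :: "complex^'d^'d \<Rightarrow> complex^'d^'d" where
  "mexp A = (\<Sum>k. (1 / fact k) *\<^sub>R mpow A k)"

text \<open>The standard Hermitian inner product, linear in the first argument. (The library's
  \<open>\<bullet>\<close> on \<^typ>\<open>complex^'d\<close> is its real part; both induce the same norm.)\<close>

definition herm :: "complex^'d \<Rightarrow> complex^'d \<Rightarrow> complex" where
  "herm v w = (\<Sum>a\<in>UNIV. v $ a * cnj (w $ a))"

definition outer :: "complex^'d \<Rightarrow> complex^'d^'d" where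
  "outer w = (\<chi> a b. w $ a * cnj (w $ b))"

lemma outer_mult_vec: "outer w *v v = herm v w *s w"
  by (simp add: outer_def herm_def matrix_vector_mult_def vec_eq_iff sum_distrib_left
      mult_ac)

definition orbit :: "real \<Rightarrow> (complex^'d^'d) set" where
  "orbit r = {r *\<^sub>R outer w |w. norm w = 1}"

subsection \<open>Eigenvalues and spectral projections\<close>

definition charpoly :: "complex^'d^'d \<Rightarrow> complex poly" where
  "charpoly A = det (mat [:0, 1:] - map_matrix (\<lambda>x. [:x:]) A)"

text \<open>The eigenvalues with multiplicity, in nonincreasing order. For Hermitian \<open>A\<close> all roots of
  the characteristic polynomial are real, so \<^const>\<open>Re\<close> is only a change of type there.
  \<open>eigval j A\<close> is the \<open>j\<close>-th largest one, counting from \<open>j = 1\<close>.\<close>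

definition eigvals :: "complex^'d^'d \<Rightarrow> real list" where
  "eigvals A = rev (sorted_list_of_multiset (image_mset Re (proots (charpoly A))))"

definition eigval :: "nat \<Rightarrow> complex^'d^'d \<Rightarrow> real" where
  "eigval j A = eigvals A ! (j - 1)"

definition simple_eigval :: "complex^'d^'d \<Rightarrow> real \<Rightarrow> bool" where
  "simple_eigval A x \<longleftrightarrow> order (complex_of_real x) (charpoly A) = 1"

definition eigenspace :: "complex^'d^'d \<Rightarrow> real \<Rightarrow> (complex^'d) set" where
  "eigenspace A x = {v. A *v v = complex_of_real x *s v}"

text \<open>The matrix of the orthogonal projection onto a complex linear subspace \<open>S\<close>.\<close>

definition orth_proj :: "(complex^'d) set \<Rightarrow> complex^'d^'d" where
  "orth_proj S = (THE P. \<forall>v. P *v v \<in> S \<and> (\<forall>w\<in>S. herm (v - P *v v) w = 0))"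

definition spec_proj :: "nat \<Rightarrow> complex^'d^'d \<Rightarrow> complex^'d^'d" where
  "spec_proj j A = orth_proj (eigenspace A (eigval j A))"

subsection \<open>The product of orbits\<close>

text \<open>An \<open>n\<close>-tuple of matrices is a function on \<^typ>\<open>nat\<close> which is only relevant on
  \<^term>\<open>{1..n}\<close>, and extensional (\<^const>\<open>undefined\<close> elsewhere) as a point of the product.\<close>

type_synonym 'd tuple = "nat \<Rightarrow> complex^'d^'d"

definition N_tilde :: "nat \<Rightarrow> (nat \<Rightarrow> real) \<Rightarrow> 'd::finite tuple set" where
  "N_tilde n r = (\<Pi>\<^sub>E k\<in>{1..n}. orbit (r k))"

definition psum :: "nat \<Rightarrow> 'd::finite tuple \<Rightarrow> complex^'d^'d" where
  "psum i e = (\<Sum>k=1..i+1. e k)"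

definition lam :: "nat \<Rightarrow> nat \<Rightarrow> 'd::finite tuple \<Rightarrow> real" where
  "lam i j e = eigval j (psum i e)"

definition simple_locus :: "nat \<Rightarrow> (nat \<Rightarrow> real) \<Rightarrow> nat \<Rightarrow> nat \<Rightarrow> 'd::finite tuple set" where
  "simple_locus n r i j = {e \<in> N_tilde n r. simple_eigval (psum i e) (lam i j e)}"

subsection \<open>Symplectic structure\<close>

definition tangent :: "complex^'d^'d \<Rightarrow> (complex^'d^'d) set" where
  "tangent X = {comm \<xi> X |\<xi>. \<xi> \<in> u_alg}"

text \<open>The Kostant--Kirillov form at \<open>X\<close>, on tangent vectors. It is independent of the choice
  of \<open>\<xi>\<close> and \<open>\<eta>\<close>, see the lemma below.\<close>

definition kk_form :: "complex^'d^'d \<Rightarrow> complex^'d^'d \<Rightarrow> complex^'d^'d \<Rightarrow> real" where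
  "kk_form X V W = (THE c. \<exists>\<xi>\<in>u_alg. \<exists>\<eta>\<in>u_alg.
     V = comm \<xi> X \<and> W = comm \<eta> X \<and> c = Im (trace (X ** comm \<xi> \<eta>)))"

lemma trace_mult_comm: "trace (X ** comm \<xi> \<eta>) = trace (X ** \<xi> ** \<eta>) - trace (X ** \<eta> ** \<xi>)"
proof -
  have "X ** comm \<xi> \<eta> = X ** (\<xi> ** \<eta>) - X ** (\<eta> ** \<xi>)"
    by (simp add: comm_def matrix_matrix_mult_def vec_eq_iff right_diff_distrib sum_subtractf)
  then show ?thesis by (simp add: trace_sub matrix_mul_assoc)
qed

lemma trace_comm_left: "trace (X ** comm \<xi> \<eta>) = - trace (\<eta> ** comm \<xi> X)"
proof -
  have "trace (X ** \<xi> ** \<eta>) = trace (\<eta> ** X ** \<xi>)" "trace (X ** \<eta> ** \<xi>) = trace (\<eta> ** \<xi> ** X)"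
    using trace_mul_sym[of "X ** \<xi>" \<eta>] trace_mul_sym[of X "\<eta> ** \<xi>"]
    by (simp_all add: matrix_mul_assoc)
  then show ?thesis by (simp add: trace_mult_comm)
qed

lemma trace_comm_right: "trace (X ** comm \<xi> \<eta>) = trace (\<xi> ** comm \<eta> X)"
proof -
  have "trace (X ** \<xi> ** \<eta>) = trace (\<xi> ** \<eta> ** X)" "trace (X ** \<eta> ** \<xi>) = trace (\<xi> ** X ** \<eta>)"
    using trace_mul_sym[of X "\<xi> ** \<eta>"] trace_mul_sym[of "X ** \<eta>" \<xi>]
    by (simp_all add: matrix_mul_assoc)
  then show ?thesis by (simp add: trace_mult_comm)
qed

lemma kk_form_comm:
  assumes "\<xi> \<in> u_alg" "\<eta> \<in> u_alg"
  shows "kk_form X (comm \<xi> X) (comm \<eta> X) = Im (trace (X ** comm \<xi> \<eta>))"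
  unfolding kk_form_def
proof (rule the_equality)
  fix c
  assume "\<exists>\<xi>'\<in>u_alg. \<exists>\<eta>'\<in>u_alg. comm \<xi> X = comm \<xi>' X \<and> comm \<eta> X = comm \<eta>' X \<and>
    c = Im (trace (X ** comm \<xi>' \<eta>'))"
  then obtain \<xi>' \<eta>' where *: "comm \<xi> X = comm \<xi>' X" "comm \<eta> X = comm \<eta>' X"
    "c = Im (trace (X ** comm \<xi>' \<eta>'))" by blast
  have "trace (X ** comm \<xi>' \<eta>') = trace (X ** comm \<xi> \<eta>')"
    using *(1) unfolding trace_comm_left[of X \<xi>' \<eta>'] trace_comm_left[of X \<xi> \<eta>'] by metis
  also have "\<dots> = trace (X ** comm \<xi> \<eta>)"
    using *(2) unfolding trace_comm_right[of X \<xi> \<eta>'] trace_comm_right[of X \<xi> \<eta>] by metis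
  finally show "c = Im (trace (X ** comm \<xi> \<eta>))" using *(3) by simp
qed (use assms in blast)

definition prod_form :: "nat \<Rightarrow> 'd::finite tuple \<Rightarrow> 'd tuple \<Rightarrow> 'd tuple \<Rightarrow> real" where
  "prod_form n e V W = (\<Sum>k=1..n. kk_form (e k) (V k) (W k))"

text \<open>\<open>\<xi>\<close> is the gradient at \<open>e\<close> of a function \<open>f\<close> of \<open>n\<close> Hermitian matrices, with respect to
  the sum of the pairings \<open>Im Tr (\<xi> Y)\<close>.\<close>

definition is_gradient ::
    "nat \<Rightarrow> ('d::finite tuple \<Rightarrow> real) \<Rightarrow> 'd tuple \<Rightarrow> 'd tuple \<Rightarrow> bool" where
  "is_gradient n f e \<xi> \<longleftrightarrow> (\<forall>k\<in>{1..n}. \<xi> k \<in> u_alg) \<and>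
     (\<forall>Y. (\<forall>k\<in>{1..n}. Y k \<in> Herm) \<longrightarrow>
       ((\<lambda>t. f (\<lambda>k\<in>{1..n}. e k + t *\<^sub>R Y k)) has_real_derivative
          (\<Sum>k=1..n. Im (trace (\<xi> k ** Y k)))) (at 0))"

text \<open>\<open>f\<close> is the Hamiltonian, on a subset \<open>U\<close> of the product of orbits, of the vector field
  \<open>V\<close>. The first conjunct says that \<open>V\<close> is the right-hand side of Hamilton's equations
  \<open>e\<^sub>k' = [\<nabla>\<^sub>k f(e), e\<^sub>k]\<close>. The second says that \<open>V\<close> is the symplectic gradient of \<open>f\<close>, namely
  \<open>\<omega>(V, W) = df(W)\<close>, with \<open>df(W)\<close> the derivative of \<open>f\<close> along every curve in the product of
  orbits with velocity \<open>W\<close>; in particular \<open>f\<close> is differentiable there.\<close>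

definition is_hamiltonian ::
    "nat \<Rightarrow> (nat \<Rightarrow> real) \<Rightarrow> 'd::finite tuple set \<Rightarrow> ('d tuple \<Rightarrow> real) \<Rightarrow>
     ('d tuple \<Rightarrow> 'd tuple) \<Rightarrow> bool" where
  "is_hamiltonian n r U f V \<longleftrightarrow> (\<forall>e\<in>U.
     (\<exists>\<xi>. is_gradient n f e \<xi> \<and> (\<forall>k\<in>{1..n}. V e k = comm (\<xi> k) (e k))) \<and>
     ((\<forall>k\<in>{1..n}. V e k \<in> tangent (e k)) \<and>
      (\<forall>\<gamma> W. (\<forall>t. \<gamma> t \<in> N_tilde n r) \<and> \<gamma> 0 = e \<and>
          (\<forall>k\<in>{1..n}. ((\<lambda>t::real. \<gamma> t k) has_vector_derivative W k) (at 0)) \<longrightarrow>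
        ((\<lambda>t. f (\<gamma> t)) has_real_derivative prod_form n e (V e) W) (at 0))))"

text \<open>Solutions in \<open>U\<close>, on a time interval \<open>T\<close>, of the system \<open>e\<^sub>k' = V(e)\<^sub>k\<close>, \<open>1 \<le> k \<le> n\<close>.\<close>

definition is_solution ::
    "nat \<Rightarrow> 'd::finite tuple set \<Rightarrow> ('d tuple \<Rightarrow> 'd tuple) \<Rightarrow> real set \<Rightarrow> (real \<Rightarrow> 'd tuple) \<Rightarrow> bool" where
  "is_solution n U V T \<gamma> \<longleftrightarrow> (\<forall>t\<in>T. \<gamma> t \<in> U \<and>
     (\<forall>k\<in>{1..n}. ((\<lambda>s. \<gamma> s k) has_vector_derivative V (\<gamma> t) k) (at t within T)))"

text \<open>\<open>\<phi>\<close> is the (complete) flow on \<open>U\<close>: \<open>\<lambda>t. \<phi> t e\<close> solves the system for all times with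
  initial point \<open>e\<close>, and every solution starting at \<open>e\<close> is a restriction of it.\<close>

definition is_flow ::
    "nat \<Rightarrow> 'd::finite tuple set \<Rightarrow> ('d tuple \<Rightarrow> 'd tuple) \<Rightarrow> (real \<Rightarrow> 'd tuple \<Rightarrow> 'd tuple) \<Rightarrow> bool" where
  "is_flow n U V \<phi> \<longleftrightarrow> (\<forall>e\<in>U.
     \<phi> 0 e = e \<and> is_solution n U V UNIV (\<lambda>t. \<phi> t e) \<and>
     (\<forall>T \<gamma>. is_interval T \<and> 0 \<in> T \<and> is_solution n U V T \<gamma> \<and> \<gamma> 0 = e \<longrightarrow>
        (\<forall>t\<in>T. \<gamma> t = \<phi> t e)))"

end

theory Submission
  imports Defs
begin

text \<open>
  A simple eigenvalue is differentiable in the Hermitian matrix, with derivative \<open>Tr (E Y)\<close> in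
  the direction \<open>Y\<close>, where \<open>E\<close> is its spectral projection. Hence the gradient of \<open>\<lambda>\<^sub>i\<^sub>j\<close> is
  \<open>\<i> E\<close> in the first \<open>i + 1\<close> slots and \<open>0\<close> in the others, which gives Hamilton's equations.
  Along any solution \<open>A\<^sub>i\<close> has velocity \<open>\<i> [E, A\<^sub>i] = 0\<close>, so \<open>E\<close> is constant in time and the
  system becomes linear with constant coefficients; it is integrated by conjugation with
  \<open>exp (\<i> t E)\<close>, which commutes with \<open>A\<^sub>i\<close>.
\<close>

text \<open>The index j refers to the decreasing order of the eigenvalues, so a smooth local branch
  of roots would still have to be matched with the j-th entry. Compactness avoids this: the ordered
  eigenvalues are continuous on all Hermitian matrices, with or without multiplicities, and at a
  simple eigenvalue the rank-one projections onto chosen unit eigenvectors converge although the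
  eigenvectors may jump by phases. Simplicity is stated through the root order of the characteristic
  polynomial, whereas the argument needs a one-dimensional eigenspace; a determinant computation
  links the two. The factor \<i> in the gradient comes from the pairing: Im Tr (\<i> E Y) = Re Tr (E
  Y) for Hermitian and all other Y. The Kostant-Kirillov form is evaluated on velocities of curves,
  which requires writing each velocity as a commutator with the point. Since E is idempotent, the
  exponential of c E is affine in E, so the scalar exponential carries the whole flow; uniqueness of
  solutions follows from vanishing derivatives rather than a Lipschitz estimate.\<close>

section \<open>Matrix algebra and its bilinear structure\<close>

lemma smat_nth: "(c *\<^sub>m A) $ a $ b = c * A $ a $ b"
  by (simp add: smat_def map_matrix_def)

lemma adj_nth: "adj A $ a $ b = cnj (A $ b $ a)"
  by (simp add: adj_def map_matrix_def transpose_def)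

lemma outer_nth: "outer w $ a $ b = w $ a * cnj (w $ b)"
  by (simp add: outer_def)

text \<open>In finite dimension bilinearity already gives boundedness. The interpretation supplies
  the sum, limit and product rules for \<open>**\<close>.\<close>

interpretation matrix_mult: bounded_bilinear
  "(**) :: complex^'d::finite^'d \<Rightarrow> complex^'d^'d \<Rightarrow> complex^'d^'d"
proof -
  have "bilinear ((**) :: complex^'d::finite^'d \<Rightarrow> complex^'d^'d \<Rightarrow> complex^'d^'d)"
    unfolding bilinear_def linear_iff
    by (simp add: matrix_matrix_mult_def vec_eq_iff algebra_simps sum.distrib scaleR_sum_right)
  then show "bounded_bilinear ((**) :: complex^'d::finite^'d \<Rightarrow> complex^'d^'d \<Rightarrow> complex^'d^'d)"
    by (simp add: bilinear_conv_bounded_bilinear)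
qed

interpretation smat_bilinear: bounded_bilinear
  "(*\<^sub>m) :: complex \<Rightarrow> complex^'d::finite^'d \<Rightarrow> complex^'d^'d"
proof -
  have "bilinear ((*\<^sub>m) :: complex \<Rightarrow> complex^'d::finite^'d \<Rightarrow> complex^'d^'d)"
    unfolding bilinear_def linear_iff
    by (simp add: smat_nth vec_eq_iff algebra_simps)
  then show "bounded_bilinear ((*\<^sub>m) :: complex \<Rightarrow> complex^'d::finite^'d \<Rightarrow> complex^'d^'d)"
    by (simp add: bilinear_conv_bounded_bilinear)
qed

lemma bounded_linear_trace: "bounded_linear (trace :: complex^'d::finite^'d \<Rightarrow> complex)"
proof -
  have "linear (trace :: complex^'d::finite^'d \<Rightarrow> complex)"
    unfolding linear_iff by (simp add: trace_def sum.distrib scaleR_sum_right)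
  then show ?thesis
    by (simp add: linear_conv_bounded_linear)
qed

lemma linear_adj: "linear (adj :: complex^'d::finite^'d \<Rightarrow> complex^'d^'d)"
  unfolding linear_iff by (simp add: adj_nth vec_eq_iff)

lemma smat_mult_left: "(c *\<^sub>m A) ** B = c *\<^sub>m (A ** B)"
  for A B :: "complex^'d::finite^'d"
  by (simp add: vec_eq_iff smat_nth matrix_matrix_mult_def sum_distrib_left mult_ac)

lemma smat_mult_right: "A ** (c *\<^sub>m B) = c *\<^sub>m (A ** B)"
  for A B :: "complex^'d::finite^'d"
  by (simp add: vec_eq_iff smat_nth matrix_matrix_mult_def sum_distrib_left mult_ac)

lemma smat_assoc: "c *\<^sub>m (d *\<^sub>m A) = (c * d) *\<^sub>m A"
  by (simp add: vec_eq_iff smat_nth)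

lemma smat_one: "1 *\<^sub>m A = A"
  by (simp add: vec_eq_iff smat_nth)

lemma smat_of_real: "complex_of_real c *\<^sub>m A = c *\<^sub>R A"
  by (simp add: vec_eq_iff smat_nth scaleR_conv_of_real[where 'a = complex])

lemma trace_smat: "trace (c *\<^sub>m A) = c * trace A"
  by (simp add: trace_def smat_nth sum_distrib_left)

lemma comm_smat_left: "comm (c *\<^sub>m A) B = c *\<^sub>m comm A B"
  by (simp add: comm_def smat_mult_left smat_mult_right smat_bilinear.diff_right)

lemma adj_mult: "adj (A ** B) = adj B ** adj A" for A B :: "complex^'d::finite^'d"
  by (simp add: vec_eq_iff adj_nth matrix_matrix_mult_def mult_ac)

lemma adj_smat: "adj (c *\<^sub>m A) = cnj c *\<^sub>m adj A"
  by (simp add: vec_eq_iff adj_nth smat_nth)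

lemma adj_mat_1: "adj (mat 1) = mat 1"
  by (simp add: vec_eq_iff adj_nth mat_def)

lemma adj_outer: "adj (outer w) = outer w"
  by (simp add: vec_eq_iff adj_nth outer_nth)

lemma outer_in_Herm: "outer w \<in> Herm"
  by (simp add: Herm_def adj_outer)

lemma HermD: "A \<in> Herm \<Longrightarrow> adj A = A"
  by (simp add: Herm_def)

lemma subspace_Herm: "subspace (Herm :: (complex^'d::finite^'d) set)"
  by (simp add: subspace_def Herm_def linear_add[OF linear_adj] linear_cmul[OF linear_adj] linear_0[OF linear_adj])

lemma closed_Herm: "closed (Herm :: (complex^'d::finite^'d) set)"
  by (rule closed_subspace[OF subspace_Herm])

section \<open>The Hermitian inner product and rank-one projections\<close>

lemma herm_self: "herm v v = complex_of_real ((norm v)\<^sup>2)"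
  by (simp add: herm_def norm_vec_def L2_set_def sum_nonneg complex_norm_square del: of_real_power)

lemma trace_outer: "trace (outer w) = complex_of_real ((norm w)\<^sup>2)"
  unfolding herm_self[symmetric] by (simp add: trace_def outer_nth herm_def)

lemma herm_mult_adj: "herm (A *v v) w = herm v (adj A *v w)"
  unfolding herm_def matrix_vector_mult_def
  by (simp add: adj_nth sum_distrib_left sum_distrib_right mult_ac) (rule sum.swap)

lemma outer_mult_outer: "outer w ** outer w = complex_of_real ((norm w)\<^sup>2) *\<^sub>m outer w"
  unfolding herm_self[symmetric]
  by (simp add: vec_eq_iff outer_nth smat_nth matrix_matrix_mult_def herm_def
      sum_distrib_left sum_distrib_right mult_ac)

lemma outer_idem: "norm w = 1 \<Longrightarrow> outer w ** outer w = outer w"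
  by (simp add: outer_mult_outer smat_one)

lemma mult_outer_adj: "A ** outer w ** adj A = outer (A *v w)"
  by (simp add: vec_eq_iff outer_nth adj_nth matrix_matrix_mult_def matrix_vector_mult_def
      sum_distrib_left sum_distrib_right mult_ac)

lemma mult_outer_eigenvector: "A *v u = c *s u \<Longrightarrow> A ** outer u = c *\<^sub>m outer u"
  by (simp add: vec_eq_iff outer_nth smat_nth matrix_matrix_mult_def matrix_vector_mult_def
      flip: mult.assoc sum_distrib_right)

lemma outer_smult: "outer (c *s w) = complex_of_real ((cmod c)\<^sup>2) *\<^sub>m outer w"
  by (simp add: vec_eq_iff outer_nth smat_nth complex_norm_square mult_ac del: of_real_power)

subsection \<open>The characteristic polynomial\<close>

lemma poly_det: "poly (det M) x = det (map_matrix (\<lambda>p. poly p x) M)"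
  by (simp add: det_def poly_sum poly_prod map_matrix_def)

lemma poly_charpoly: "poly (charpoly A) x = det (mat x - A)"
  unfolding charpoly_def poly_det
  by (rule arg_cong[of _ _ det]) (auto simp: map_matrix_def vec_eq_iff mat_def)

text \<open>In the Leibniz expansion a permutation other than the identity moves some index and so
  picks an off-diagonal, hence constant, entry. Its term has degree below the dimension, and the top
  coefficient comes from the diagonal product alone.\<close>

lemma charpoly_monic:
  fixes A :: "complex^'d::finite^'d"
  shows "degree (charpoly A) = CARD('d)" "lead_coeff (charpoly A) = 1"
proof -
  define M where "M = mat [:0, 1:] - map_matrix (\<lambda>x. [:x:]) A"
  have M: "M $ a $ b = (if a = b then [:- (A $ a $ a), 1:] else [:- (A $ a $ b):])" for a b
    by (simp add: M_def mat_def map_matrix_def)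
  define f where "f p = of_int (sign p) * (\<Prod>a\<in>UNIV. M $ a $ p a)" for p
  have sgn: "degree (of_int (sign p) :: complex poly) = 0" for p :: "'d \<Rightarrow> 'd"
    by simp
  have deg: "degree (f p) < CARD('d)" if "p \<noteq> id" for p
  proof -
    obtain a where a: "p a \<noteq> a" using \<open>p \<noteq> id\<close> by fastforce
    have "degree (f p) \<le> degree (of_int (sign p) :: complex poly) + degree (\<Prod>a\<in>UNIV. M $ a $ p a)"
      unfolding f_def by (rule degree_mult_le)
    also have "\<dots> \<le> (\<Sum>a\<in>UNIV. degree (M $ a $ p a))"
      using degree_prod_sum_le[of UNIV "\<lambda>a. M $ a $ p a"] sgn[of p] by simp
    also have "\<dots> < (\<Sum>a\<in>(UNIV :: 'd set). 1)"
      by (rule sum_strict_mono_ex1) (use a in \<open>auto simp: M intro!: exI[of _ a]\<close>)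
    finally show ?thesis by simp
  qed
  have id: "f id = (\<Prod>a\<in>UNIV. [:- (A $ a $ a), 1:])"
    by (simp add: f_def M)
  have degid: "degree (f id) = CARD('d)"
    by (simp add: id degree_prod_sum_eq)
  have leadid: "lead_coeff (f id) = 1"
    by (simp add: id lead_coeff_prod)
  have eq: "charpoly A = (\<Sum>p | p permutes UNIV. f p)"
    by (simp add: charpoly_def M_def[symmetric] det_def f_def)
  have cf: "coeff (f p) k = (if p = id then coeff (f id) k else 0)" if "k \<ge> CARD('d)" for p k
    using deg[of p] that by (auto intro: coeff_eq_0)
  have co: "coeff (charpoly A) k = coeff (f id) k" if "k \<ge> CARD('d)" for k
  proof -
    have "(\<Sum>p | p permutes (UNIV :: 'd set). coeff (f p) k) =
        (\<Sum>p | p permutes (UNIV :: 'd set). if p = id then coeff (f id) k else 0)"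
      by (intro sum.cong refl cf that)
    also have "\<dots> = coeff (f id) k"
      by (subst sum.delta) (auto simp: permutes_id)
    finally show ?thesis by (simp add: eq coeff_sum)
  qed
  have 1: "coeff (charpoly A) (CARD('d)) = 1"
    using co[of "CARD('d)"] degid leadid by simp
  moreover have "coeff (charpoly A) k = 0" if "k > CARD('d)" for k
    using co[of k] degid that by (simp add: coeff_eq_0)
  ultimately show "degree (charpoly A) = CARD('d)"
    by (metis degree_le le_degree le_antisym zero_neq_one)
  with 1 show "lead_coeff (charpoly A) = 1" by simp
qed

lemma charpoly_nonzero: "charpoly A \<noteq> 0"
  using charpoly_monic(2)[of A] by auto

lemma charpoly_root_iff:
  "poly (charpoly A) x = 0 \<longleftrightarrow> (\<exists>v. norm v = 1 \<and> A *v v = x *s v)"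
proof -
  have kernel: "(mat x - A) *v v = 0 \<longleftrightarrow> A *v v = x *s v" for v
  proof -
    have "mat x *v v = x *s v"
      by (simp add: vec_eq_iff matrix_vector_mult_def mat_def if_distrib[of "\<lambda>u. u * _"] cong: if_cong)
    then show ?thesis by (auto simp: matrix_vector_mult_diff_rdistrib)
  qed
  have "poly (charpoly A) x = 0 \<longleftrightarrow> (\<exists>v. v \<noteq> 0 \<and> (mat x - A) *v v = 0)"
    using invertible_det_nz[of "mat x - A"] matrix_left_invertible_ker[of "mat x - A"]
    by (auto simp: poly_charpoly invertible_left_inverse)
  also have "\<dots> \<longleftrightarrow> (\<exists>v. v \<noteq> 0 \<and> A *v v = x *s v)"
    by (simp add: kernel)
  also have "\<dots> \<longleftrightarrow> (\<exists>v. norm v = 1 \<and> A *v v = x *s v)"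
  proof
    assume "\<exists>v. v \<noteq> 0 \<and> A *v v = x *s v"
    then obtain v where v: "v \<noteq> 0" "A *v v = x *s v" by blast
    have "(1 / norm v) *\<^sub>R v = complex_of_real (1 / norm v) *s v"
      by (simp add: vec_eq_iff scaleR_conv_of_real[where 'a = complex])
    then have "A *v ((1 / norm v) *\<^sub>R v) = x *s ((1 / norm v) *\<^sub>R v)"
      using v by (simp add: vec.scale mult_ac)
    with v show "\<exists>v. norm v = 1 \<and> A *v v = x *s v"
      by (intro exI[of _ "(1 / norm v) *\<^sub>R v"]) simp
  qed (metis norm_zero zero_neq_one)
  finally show ?thesis .
qed

text \<open>Geometric multiplicity is at most algebraic multiplicity. Two independent eigenvectors,
  placed as rows of an invertible matrix, make two rows of a product divisible by t - x, which
  forces a double root.\<close>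

lemma charpoly_simple_root_eigenspace:
  fixes A :: "complex^'d::finite^'d"
  assumes ord: "order x (charpoly A) = 1"
    and w: "w \<noteq> 0" "A *v w = x *s w" and v: "A *v v = x *s v"
  shows "\<exists>c. v = c *s w"
proof (rule ccontr)
  assume no: "\<not> ?thesis"
  obtain a where a: "w $ a \<noteq> 0" using w(1) by (auto simp: vec_eq_iff)
  \<comment> \<open>Eliminating coordinate \<open>a\<close> from \<open>v\<close> by means of
    \<open>w\<close> keeps an eigenvector for \<open>x\<close> and yields independence that can be
    read off coordinates.\<close>
  define u where "u = v - (v $ a / w $ a) *s w"
  have "u \<noteq> 0" using no by (auto simp: u_def)
  then obtain b where b: "u $ b \<noteq> 0" by (auto simp: vec_eq_iff)
  have ua: "u $ a = 0" using a by (simp add: u_def)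
  have ab: "a \<noteq> b" using ua b by auto
  have u: "A *v u = x *s u"
    by (simp add: u_def matrix_vector_mult_diff_distrib vec.scale v w(2) vec.scale_right_diff_distrib
        mult.commute)
  \<comment> \<open>The eigenvectors sit in rows \<open>a\<close> and \<open>b\<close>, standard
    basis vectors in the others. Column \<open>a\<close> of a vanishing row combination kills the
    coefficient of \<open>w\<close>, then column \<open>b\<close> that of \<open>u\<close>, then the
    remaining columns the rest.\<close>
  define Q :: "complex^'d^'d" where
    "Q = (\<chi> c. if c = a then w else if c = b then u else axis c 1)"
  have "\<exists>B. Q ** B = mat 1"
    unfolding matrix_right_invertible_independent_rows
  proof (intro allI impI)
    fix c :: "'d \<Rightarrow> complex" and i
    assume *: "(\<Sum>i\<in>UNIV. c i *s row i Q) = 0"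
    have **: "(\<Sum>i\<in>UNIV. c i * Q $ i $ k) = 0" for k
      using arg_cong[OF *, of "\<lambda>z. z $ k"] by (simp add: row_def)
    have "(\<Sum>i\<in>UNIV. c i * Q $ i $ a) = (\<Sum>i\<in>UNIV. if i = a then c a * w $ a else 0)"
      by (rule sum.cong) (auto simp: Q_def ua axis_def)
    then have ca: "c a = 0" using ** a by simp
    have "(\<Sum>i\<in>UNIV. c i * Q $ i $ b) = (\<Sum>i\<in>UNIV. if i = b then c b * u $ b else 0)"
      by (rule sum.cong) (use ab in \<open>auto simp: Q_def ca axis_def\<close>)
    then have cb: "c b = 0" using ** b by simp
    have "(\<Sum>j\<in>UNIV. c j * Q $ j $ i) = (\<Sum>j\<in>UNIV. if j = i then c i else 0)"
      by (rule sum.cong) (use ca cb in \<open>auto simp: Q_def axis_def\<close>)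
    then show "c i = 0" using ** by simp
  qed
  then have detQ: "det Q \<noteq> 0"
    by (metis det_mul det_I mult_zero_left zero_neq_one)
  define P where "P = map_matrix (\<lambda>x. [:x:]) Q"
  \<comment> \<open>The transpose lets the characteristic matrix act on rows: a row q of
    \<open>Q\<close> becomes (t - A) q in \<open>P ** M\<close>, which is (t - x) q for an
    eigenvector.\<close>
  define M where "M = transpose (mat [:0, 1:] - map_matrix (\<lambda>x. [:x:]) A)"
  have detM: "det M = charpoly A" by (simp add: M_def charpoly_def)
  have detP: "poly (det P) x = det Q"
    by (simp add: poly_det P_def map_matrix_def)
  define f where "f c = (if c = a \<or> c = b then [:-x, 1:] else 1)" for c
  define R where "R c = (if c = a \<or> c = b then (\<chi> k. [:Q $ c $ k:]) else (P ** M) $ c)" for c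
  have row: "(P ** M) $ c = [:-x, 1:] *s (\<chi> k. [:q $ k:])"
    if q: "Q $ c = q" "A *v q = x *s q" for c q
  proof -
    have "(P ** M) $ c $ k = ([:-x, 1:] *s (\<chi> k. [:q $ k:])) $ k" for k
    proof (rule poly_eq_poly_eq_iff[THEN iffD1], rule ext)
      fix z
      have "x * q $ k = (\<Sum>l\<in>UNIV. q $ l * A $ k $ l)"
        using arg_cong[OF q(2), of "\<lambda>y. y $ k"] by (simp add: matrix_vector_mult_def mult.commute)
      moreover have "(\<Sum>l\<in>UNIV. q $ l * poly (mat [:0, 1:] $ k $ l) z) = q $ k * z"
      proof -
        have "(\<Sum>l\<in>UNIV. q $ l * poly (mat [:0, 1:] $ k $ l) z)
          = (\<Sum>l\<in>UNIV. if l = k then q $ k * z else 0)"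
          by (rule sum.cong) (auto simp: mat_def)
        then show ?thesis by simp
      qed
      ultimately show "poly ((P ** M) $ c $ k) z = poly (([:-x, 1:] *s (\<chi> k. [:q $ k:])) $ k) z"
        by (simp add: matrix_matrix_mult_def P_def M_def map_matrix_def transpose_def poly_sum q(1)
            right_diff_distrib sum_subtractf algebra_simps)
    qed
    then show ?thesis by (simp add: vec_eq_iff)
  qed
  have "P ** M = (\<chi> c. f c *s R c)"
  proof -
    have "(P ** M) $ c = f c *s R c" for c
      using row[of a w] row[of b u] w(2) u ab
      by (simp add: f_def R_def Q_def)
    then show ?thesis by (simp add: vec_eq_iff)
  qed
  then have "det P * charpoly A = prod f UNIV * det (\<chi> c. R c)"
    using det_rows_mul[of f R] by (simp flip: detM det_mul)
  also have "prod f UNIV = prod f {a, b}"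
    by (rule prod.mono_neutral_right) (auto simp: f_def)
  also have "\<dots> = [:-x, 1:]^2"
    using ab by (simp add: f_def power2_eq_square)
  finally have "[:-x, 1:]^2 dvd det P * charpoly A" by simp
  moreover have "det P \<noteq> 0" using detP detQ by auto
  \<comment> \<open>\<open>det P\<close> does not vanish at \<open>x\<close>, so both factors t - x
    must divide \<open>charpoly A\<close>.\<close>
  moreover have "order x (det P) = 0" using detP detQ by (simp add: order_0I)
  ultimately have "2 \<le> order x (charpoly A)"
    by (simp add: order_divides order_mult charpoly_nonzero)
  with ord show False by simp
qed

subsection \<open>Eigenvalues of Hermitian matrices\<close>

lemma Herm_eigenvalue_real:
  assumes "A \<in> Herm" "poly (charpoly A) x = 0"
  shows "x = complex_of_real (Re x)"
proof -
  obtain v where v: "norm v = 1" "A *v v = x *s v"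
    using assms(2) charpoly_root_iff by blast
  have "x * herm v v = herm (A *v v) v"
    by (simp add: v(2) herm_def sum_distrib_left mult_ac)
  also have "\<dots> = herm v (A *v v)"
    by (simp add: herm_mult_adj HermD[OF assms(1)])
  also have "\<dots> = cnj x * herm v v"
    by (simp add: v(2) herm_def sum_distrib_left mult_ac)
  finally have "x = cnj x" by (simp add: herm_self v(1))
  then show ?thesis by (simp add: complex_eq_iff)
qed

lemma mset_eigvals: "mset (eigvals A) = image_mset Re (proots (charpoly A))"
  by (simp add: eigvals_def)

lemma length_eigvals: "length (eigvals A) = CARD('d)" for A :: "complex^'d::finite^'d"
  using arg_cong[OF mset_eigvals[of A], of size]
  by (simp add: size_proots_complex charpoly_monic)

text \<open>All roots are real, so the passage through \<open>Re\<close> in \<open>eigvals\<close>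
  loses nothing.\<close>

lemma proots_charpoly_Herm:
  assumes "A \<in> Herm"
  shows "proots (charpoly A) = image_mset complex_of_real (mset (eigvals A))"
proof -
  have "image_mset (\<lambda>x. complex_of_real (Re x)) (proots (charpoly A)) = image_mset (\<lambda>x. x) (proots (charpoly A))"
    by (rule image_mset_cong) (use assms Herm_eigenvalue_real charpoly_nonzero in \<open>metis mem_Collect_eq set_count_proots\<close>)
  then show ?thesis by (simp add: mset_eigvals multiset.map_comp o_def)
qed

lemma charpoly_eigvals:
  assumes "A \<in> Herm"
  shows "charpoly A = (\<Prod>y\<leftarrow>eigvals A. [:- complex_of_real y, 1:])"
proof -
  have "charpoly A = (\<Prod>x\<in>#proots (charpoly A). [:-x, 1:])"
    using complex_poly_decompose_multiset[of "charpoly A"] charpoly_monic(2)[of A] by simp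
  also have "\<dots> = (\<Prod>y\<in>#mset (eigvals A). [:- complex_of_real y, 1:])"
    by (simp add: proots_charpoly_Herm[OF assms] multiset.map_comp o_def)
  also have "\<dots> = (\<Prod>y\<leftarrow>eigvals A. [:- complex_of_real y, 1:])"
    by (simp flip: prod_mset_prod_list)
  finally show ?thesis .
qed

lemma sorted_rev_eigvals: "sorted (rev (eigvals A))"
  by (simp add: eigvals_def)

text \<open>A multiset has only one decreasing arrangement. This serves to recognise a limit of
  eigenvalue lists as the eigenvalue list of the limit matrix.\<close>

lemma eigvals_unique:
  assumes "charpoly A = (\<Prod>y\<leftarrow>ys. [:- complex_of_real y, 1:])" "sorted (rev ys)"
  shows "eigvals A = ys"
proof -
  have "proots (\<Prod>y\<leftarrow>ys. [:- complex_of_real y, 1:]) = image_mset complex_of_real (mset ys)"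
    by (induction ys) (simp_all add: proots_mult prod_list_zero_iff image_iff del: mult_pCons_left)
  then have "image_mset Re (proots (charpoly A)) = mset ys"
    by (simp add: assms(1) multiset.map_comp o_def)
  then have "eigvals A = rev (sort ys)"
    by (simp add: eigvals_def)
  also have "sort ys = rev ys"
    using assms(2) by (metis mset_rev properties_for_sort)
  finally show ?thesis by simp
qed

text \<open>The root order counts the positions in \<open>eigvals A\<close> that carry the given
  value. Simplicity thereby becomes finitely many inequations between functions continuous in
  \<open>A\<close>. The shift to \<open>j - 1\<close> is due to lists being indexed from 0.\<close>

lemma simple_eigval_iff:
  fixes A :: "complex^'d::finite^'d"
  assumes "A \<in> Herm" "1 \<le> j" "j \<le> CARD('d)"
  shows "simple_eigval A (eigval j A) \<longleftrightarrow>
    (\<forall>k\<in>{..<CARD('d)} - {j - 1}. eigvals A ! k \<noteq> eigvals A ! (j - 1))"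
proof -
  let ?l = "eigvals A ! (j - 1)" and ?S = "{k. k < CARD('d) \<and> eigvals A ! (j - 1) = eigvals A ! k}"
  have "order (complex_of_real ?l) (charpoly A) = count (mset (eigvals A)) ?l"
  proof -
    have "count (image_mset complex_of_real M) (complex_of_real y) = count M y" for M y
      by (induction M) auto
    then show ?thesis
      by (simp flip: count_proots add: charpoly_nonzero proots_charpoly_Herm[OF assms(1)])
  qed
  also have "\<dots> = card ?S"
    unfolding count_mset count_list_eq_length_filter length_filter_conv_card length_eigvals ..
  finally have 1: "order (complex_of_real ?l) (charpoly A) = card ?S" .
  have 2: "card ?S = 1 \<longleftrightarrow> ?S = {j - 1}"
  proof
    assume "card ?S = 1"
    then obtain y where y: "?S = {y}" by (auto simp: card_Suc_eq)
    moreover have "j - 1 \<in> ?S" using assms by auto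
    ultimately show "?S = {j - 1}" by auto
  qed simp
  have "j - 1 < CARD('d)" using assms by simp
  then have "?S = {j - 1} \<longleftrightarrow>
      (\<forall>k\<in>{..<CARD('d)} - {j - 1}. eigvals A ! k \<noteq> eigvals A ! (j - 1))"
    unfolding set_eq_iff mem_Collect_eq Ball_def Diff_iff lessThan_iff singleton_iff by metis
  then show ?thesis
    unfolding simple_eigval_def eigval_def 1 2 .
qed

subsection \<open>Continuity of the eigenvalues\<close>

text \<open>If infinitely many terms stayed away from \<open>l\<close>, compactness would give a
  convergent subsequence of them, whose limit is \<open>l\<close> by assumption. It is applied to
  eigenvalue vectors and to eigenprojections.\<close>

lemma tendsto_compact_unique_limit:
  fixes X :: "nat \<Rightarrow> 'a::metric_space"
  assumes K: "compact K" "\<And>n. X n \<in> K"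
    and lim: "\<And>s x. strict_mono s \<Longrightarrow> (X \<circ> s) \<longlonglongrightarrow> x \<Longrightarrow> x = l"
  shows "X \<longlonglongrightarrow> l"
proof (rule ccontr)
  assume "\<not> X \<longlonglongrightarrow> l"
  then obtain \<epsilon> where \<epsilon>: "\<epsilon> > 0" "\<And>N. \<exists>n\<ge>N. dist (X n) l \<ge> \<epsilon>"
    by (auto simp: lim_sequentially not_less)
  then have "infinite {n. dist (X n) l \<ge> \<epsilon>}"
    by (auto simp: infinite_nat_iff_unbounded_le)
  then obtain s :: "nat \<Rightarrow> nat" where s: "strict_mono s" "\<And>n. dist (X (s n)) l \<ge> \<epsilon>"
    using infinite_enumerate by blast
  have "\<forall>n. (X \<circ> s) n \<in> K" using K(2) by simp
  then obtain x s' where s': "strict_mono s'" "((X \<circ> s) \<circ> s') \<longlonglongrightarrow> x"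
    using K(1) by (meson compact_def)
  have "(X \<circ> (s \<circ> s')) \<longlonglongrightarrow> l"
    using lim[OF strict_mono_o[OF s(1) s'(1)], of x] s'(2) by (simp add: o_assoc)
  then obtain n where "dist (X (s (s' n))) l < \<epsilon>"
    using \<epsilon>(1) by (fastforce simp: lim_sequentially)
  with s(2)[of "s' n"] show False by simp
qed

lemma matrix_vector_mult_bounded_bilinear:
  "bounded_bilinear ((*v) :: complex^'d::finite^'d \<Rightarrow> complex^'d \<Rightarrow> complex^'d)"
proof -
  have "bilinear ((*v) :: complex^'d::finite^'d \<Rightarrow> complex^'d \<Rightarrow> complex^'d)"
    unfolding bilinear_def linear_iff
    by (simp add: matrix_vector_mult_def vec_eq_iff algebra_simps sum.distrib scaleR_sum_right)
  then show ?thesis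
    by (simp add: bilinear_conv_bounded_bilinear)
qed

lemma norm_smult_complex: "norm (c *s v) = cmod c * norm v" for v :: "complex^'d::finite"
  by (simp add: norm_vec_def L2_set_def norm_mult power_mult_distrib real_sqrt_mult
      flip: sum_distrib_left)

lemma eigvals_eigenvector:
  fixes A :: "complex^'d::finite^'d"
  assumes "A \<in> Herm" "k < CARD('d)"
  obtains v where "norm v = 1" "A *v v = complex_of_real (eigvals A ! k) *s v"
proof -
  have "eigvals A ! k \<in># mset (eigvals A)"
    using assms(2) by (simp add: length_eigvals)
  then have "complex_of_real (eigvals A ! k) \<in># proots (charpoly A)"
    by (simp add: proots_charpoly_Herm[OF assms(1)])
  then have "poly (charpoly A) (complex_of_real (eigvals A ! k)) = 0"
    by (simp add: charpoly_nonzero)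
  then show ?thesis
    using that charpoly_root_iff by blast
qed

text \<open>Apply the matrix to a unit eigenvector; \<open>C\<close> is a bound for the bilinear map
  \<open>*v\<close>. This confines the eigenvalues of a convergent sequence to a compact
  set.\<close>

lemma eigvals_bound:
  obtains C where "\<And>(A :: complex^'d::finite^'d) k. A \<in> Herm \<Longrightarrow> k < CARD('d) \<Longrightarrow>
    \<bar>eigvals A ! k\<bar> \<le> C * norm A"
proof -
  obtain C where C: "\<And>(A :: complex^'d^'d) v. norm (A *v v) \<le> norm A * norm v * C"
    using bounded_bilinear.bounded[OF matrix_vector_mult_bounded_bilinear] by blast
  have "\<bar>eigvals A ! k\<bar> \<le> C * norm A" if *: "A \<in> Herm" "k < CARD('d)" for A :: "complex^'d^'d" and k
  proof -
    obtain v where v: "norm v = 1" "A *v v = complex_of_real (eigvals A ! k) *s v"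
      using eigvals_eigenvector[OF *] by blast
    then show ?thesis using C[of A v] by (simp add: norm_smult_complex mult.commute)
  qed
  with that show ?thesis by blast
qed

lemma tendsto_det:
  fixes A :: "complex^'d::finite^'d"
  assumes "(f \<longlongrightarrow> A) F"
  shows "((\<lambda>t. det (f t)) \<longlongrightarrow> det A) F"
  unfolding det_def by (intro tendsto_intros assms)

lemma poly_prod_list_map: "poly (\<Prod>y\<leftarrow>ys. f y) x = (\<Prod>y\<leftarrow>ys. poly (f y) x)"
  by (induction ys) auto

lemma det_diff_eigvals:
  fixes A :: "complex^'d::finite^'d"
  assumes "A \<in> Herm"
  shows "det (mat x - A) = (\<Prod>k<CARD('d). x - complex_of_real (eigvals A ! k))"
proof -
  have "det (mat x - A) = (\<Prod>y\<leftarrow>eigvals A. x - complex_of_real y)"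
    unfolding poly_charpoly[symmetric] charpoly_eigvals[OF assms]
    by (simp add: poly_prod_list_map)
  also have "\<dots> = (\<Prod>k<CARD('d). x - complex_of_real (eigvals A ! k))"
    by (simp add: prod.list_conv_set_nth length_eigvals atLeast0LessThan)
  finally show ?thesis .
qed

text \<open>The vector of ordered eigenvalues stays in a compact set, and every limit point of it is
  ordered and factors the limiting characteristic polynomial.\<close>

lemma tendsto_eigvals:
  fixes A :: "complex^'d::finite^'d"
  assumes H: "\<And>n. H n \<in> Herm" and lim: "H \<longlonglongrightarrow> A" and k: "k < CARD('d)"
  shows "(\<lambda>n. eigvals (H n) ! k) \<longlonglongrightarrow> eigvals A ! k"
proof -
  have A: "A \<in> Herm"
    using closed_sequentially[OF closed_Herm H lim] .
  \<comment> \<open>An enumeration of the index type turns eigenvalue lists into points of a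
    Euclidean space, where closed balls are compact.\<close>
  obtain h :: "'d \<Rightarrow> nat" where h: "bij_betw h UNIV {..<CARD('d)}"
    using ex_bij_betw_finite_nat[of "UNIV :: 'd set"] by (auto simp: atLeast0LessThan)
  define g where "g = inv_into UNIV h"
  have hg: "h (g l) = l" if "l < CARD('d)" for l
    using h that by (simp add: g_def bij_betw_inv_into_right)
  have gh: "g (h c) = c" for c
    using h by (simp add: g_def bij_betw_inv_into_left)
  have hless: "h c < CARD('d)" for c
    using h bij_betwE by blast
  define L :: "complex^'d^'d \<Rightarrow> real^'d" where "L M = (\<chi> c. eigvals M ! h c)" for M
  obtain C where C: "\<And>(A :: complex^'d^'d) k. A \<in> Herm \<Longrightarrow> k < CARD('d) \<Longrightarrow>
    \<bar>eigvals A ! k\<bar> \<le> C * norm A"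
    using eigvals_bound by blast
  obtain B where B: "\<And>n. norm (H n) \<le> B"
    using convergent_imp_Bseq[of H] lim by (auto simp: convergent_def Bseq_def)
  have "norm (L (H n)) \<le> (\<Sum>c\<in>(UNIV :: 'd set). \<bar>C\<bar> * B)" for n
  proof -
    have "\<bar>L (H n) $ c\<bar> \<le> \<bar>C\<bar> * B" for c
    proof -
      have "\<bar>L (H n) $ c\<bar> \<le> C * norm (H n)"
        using C[OF H hless] by (simp add: L_def)
      also have "\<dots> \<le> \<bar>C\<bar> * B"
        using B[of n] by (intro mult_mono) auto
      finally show ?thesis .
    qed
    then show ?thesis
      by (intro order_trans[OF norm_le_l1_cart] sum_mono) auto
  qed
  then have K: "L (H n) \<in> cball 0 (\<Sum>c\<in>(UNIV :: 'd set). \<bar>C\<bar> * B)" for n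
    by simp
  have "(\<lambda>n. L (H n)) \<longlonglongrightarrow> L A"
  proof (rule tendsto_compact_unique_limit[OF compact_cball K])
    fix s :: "nat \<Rightarrow> nat" and y
    assume s: "strict_mono s" and y: "((\<lambda>n. L (H n)) \<circ> s) \<longlonglongrightarrow> y"
    define ys where "ys = map (\<lambda>l. y $ g l) [0..<CARD('d)]"
    have ylim: "(\<lambda>n. eigvals (H (s n)) ! l) \<longlonglongrightarrow> y $ g l" if "l < CARD('d)" for l
      using tendsto_vec_nth[OF y, of "g l"] hg[OF that] by (simp add: L_def o_def)
    have Hs: "(\<lambda>n. H (s n)) \<longlonglongrightarrow> A"
      using LIMSEQ_subseq_LIMSEQ[OF lim s] by (simp add: o_def)
    have "sorted_wrt (\<ge>) ys"
      unfolding sorted_wrt_iff_nth_less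
    proof (intro allI impI)
      fix a b assume ab: "a < b" "b < length ys"
      have b: "b < CARD('d)" using ab by (simp add: ys_def)
      have "sorted_wrt (\<ge>) (eigvals (H n))" for n
        using sorted_rev_eigvals[of "H n"] by (simp add: sorted_wrt_rev)
      then have "eigvals (H (s n)) ! b \<le> eigvals (H (s n)) ! a" for n
        using ab b by (simp add: sorted_wrt_iff_nth_less length_eigvals)
      then have "y $ g b \<le> y $ g a"
        using ab b by (intro LIMSEQ_le[OF ylim ylim]) auto
      then show "ys ! b \<le> ys ! a" using ab b by (simp add: ys_def)
    qed
    then have sorted: "sorted (rev ys)" by (simp add: sorted_wrt_rev)
    \<comment> \<open>The two polynomials are compared pointwise: both values are limits of the
      determinants of x - H along the subsequence.\<close>
    have "charpoly A = (\<Prod>y\<leftarrow>ys. [:- complex_of_real y, 1:])"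
    proof (rule poly_eq_poly_eq_iff[THEN iffD1], rule ext)
      fix x
      have "(\<lambda>n. det (mat x - H (s n))) \<longlonglongrightarrow> det (mat x - A)"
        by (intro tendsto_det tendsto_intros Hs)
      moreover have "(\<lambda>n. det (mat x - H (s n))) \<longlonglongrightarrow> (\<Prod>l<CARD('d). x - complex_of_real (y $ g l))"
        unfolding det_diff_eigvals[OF H] by (intro tendsto_intros ylim) simp
      ultimately have "det (mat x - A) = (\<Prod>l<CARD('d). x - complex_of_real (y $ g l))"
        by (rule LIMSEQ_unique)
      also have "\<dots> = (\<Prod>y\<leftarrow>ys. x - complex_of_real y)"
        by (simp add: prod.list_conv_set_nth ys_def atLeast0LessThan)
      finally show "poly (charpoly A) x = poly (\<Prod>y\<leftarrow>ys. [:- complex_of_real y, 1:]) x"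
        by (simp add: poly_charpoly poly_prod_list_map)
    qed
    then have "eigvals A = ys"
      using sorted by (rule eigvals_unique)
    then show "y = L A"
      using hless by (simp add: L_def vec_eq_iff ys_def gh)
  qed
  from tendsto_vec_nth[OF this, of "g k"] show ?thesis
    using hg[OF k] by (simp add: L_def)
qed

lemma continuous_on_eigvals:
  fixes k :: nat
  assumes "k < CARD('d)"
  shows "continuous_on Herm (\<lambda>A :: complex^'d::finite^'d. eigvals A ! k)"
  unfolding continuous_on_sequentially
  using tendsto_eigvals[OF _ _ assms] by (auto simp: o_def)

text \<open>The set is a finite intersection of the sets \<open>D k\<close>, on each of which the
  continuous difference between the eigenvalue at position \<open>k\<close> and the one at
  \<open>j - 1\<close> is nonzero.\<close>

lemma openin_simple_eigval:
  assumes "1 \<le> j" "j \<le> CARD('d)"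
  shows "openin (top_of_set Herm) {A \<in> Herm. simple_eigval A (eigval j (A :: complex^'d::finite^'d))}"
proof -
  have j: "j - 1 < CARD('d)" using assms by simp
  define D where "D k = Herm \<inter> (\<lambda>A :: complex^'d^'d. eigvals A ! k - eigvals A ! (j - 1)) -` (- {0})" for k
  have "openin (top_of_set Herm) (D k)" if "k < CARD('d)" for k
    unfolding D_def using that j
    by (intro continuous_openin_preimage_gen continuous_intros continuous_on_eigvals) auto
  then have "openin (top_of_set Herm) (Herm \<inter> \<Inter> (D ` ({..<CARD('d)} - {j - 1})))"
    by (auto intro!: openin_Int_Inter)
  also have "Herm \<inter> \<Inter> (D ` ({..<CARD('d)} - {j - 1})) =
      {A \<in> Herm. simple_eigval A (eigval j A)}"
    using assms by (auto simp: D_def simple_eigval_iff)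
  finally show ?thesis .
qed

subsection \<open>Simple eigenvalues\<close>

lemma herm_diff_left: "herm (u - v) w = herm u w - herm v w"
  by (simp add: herm_def left_diff_distrib sum_subtractf)

lemma herm_smult_left: "herm (c *s v) w = c * herm v w"
  by (simp add: herm_def sum_distrib_left mult_ac)

lemma herm_smult_right: "herm v (c *s w) = cnj c * herm v w"
  by (simp add: herm_def sum_distrib_left mult_ac)

text \<open>Existence and uniqueness of the projection onto a line, as the definite description in
  \<open>orth_proj\<close> demands: the coefficient of \<open>w\<close> is forced to be
  \<open>herm v w\<close> by orthogonality.\<close>

lemma orth_proj_line:
  fixes w :: "complex^'d::finite"
  assumes "norm w = 1"
  shows "orth_proj {c *s w |c. True} = outer w"
  unfolding orth_proj_def
proof (rule the_equality)
  show "\<forall>v. outer w *v v \<in> {c *s w |c. True} \<and>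
      (\<forall>u\<in>{c *s w |c. True}. herm (v - outer w *v v) u = 0)"
    using assms
    by (auto simp: outer_mult_vec herm_diff_left herm_smult_left herm_smult_right herm_self)
next
  fix P :: "complex^'d^'d"
  assume P: "\<forall>v. P *v v \<in> {c *s w |c. True} \<and> (\<forall>u\<in>{c *s w |c. True}. herm (v - P *v v) u = 0)"
  have "P *v v = outer w *v v" for v
  proof -
    obtain c where c: "P *v v = c *s w" using P by blast
    have "w = 1 *s w" by simp
    then have "herm (v - P *v v) w = 0" using P by blast
    then have "herm v w = c"
      using assms by (simp add: c herm_diff_left herm_smult_left herm_self)
    with c show ?thesis by (simp add: outer_mult_vec)
  qed
  then show "P = outer w" by (simp add: matrix_eq)
qed

text \<open>Unit vectors on one complex line differ by a phase, and \<open>outer\<close> is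
  insensitive to phases. Any unit eigenvector therefore produces the spectral projection, which is
  what identifies limits later.\<close>

lemma simple_spec_proj:
  fixes A :: "complex^'d::finite^'d"
  assumes "simple_eigval A (eigval j A)"
  obtains w where "norm w = 1" "A *v w = complex_of_real (eigval j A) *s w"
    "spec_proj j A = outer w"
    "\<And>u. norm u = 1 \<Longrightarrow> A *v u = complex_of_real (eigval j A) *s u \<Longrightarrow> outer u = outer w"
proof -
  let ?x = "complex_of_real (eigval j A)"
  have ord: "order ?x (charpoly A) = 1"
    using assms by (simp add: simple_eigval_def)
  then have "poly (charpoly A) ?x = 0"
    by (simp add: order_root charpoly_nonzero)
  then obtain w where w: "norm w = 1" "A *v w = ?x *s w"
    using charpoly_root_iff by blast
  have line: "\<exists>c. u = c *s w" if "A *v u = ?x *s u" for u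
    using charpoly_simple_root_eigenspace[OF ord _ w(2) that] w(1) by force
  have "eigenspace A (eigval j A) = {c *s w |c. True}"
    using line w(2) by (force simp: eigenspace_def vec.scale mult.commute)
  then have "spec_proj j A = outer w"
    using orth_proj_line[OF w(1)] by (simp add: spec_proj_def)
  moreover have "outer u = outer w" if u: "norm u = 1" "A *v u = ?x *s u" for u
  proof -
    obtain c where c: "u = c *s w" using line u(2) by blast
    then have "cmod c = 1" using u(1) w(1) by (simp add: norm_smult_complex)
    then show ?thesis by (simp add: c outer_smult smat_one)
  qed
  ultimately show ?thesis using that w by blast
qed

lemma continuous_on_outer: "continuous_on S (outer :: complex^'d::finite \<Rightarrow> _)"
  unfolding outer_def by (intro continuous_intros)

lemma compact_outer_sphere: "compact (outer ` sphere (0 :: complex^'d::finite) 1)"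
  by (intro compact_continuous_image continuous_on_outer) simp

text \<open>The chosen eigenvectors may fail to converge because of their phases, but their
  projections lie in a compact set. The eigenvalue equation survives in a limit point
  \<open>F\<close>, which is again a rank-one projection, so simplicity at \<open>A\<close>
  identifies it.\<close>

lemma tendsto_spec_proj:
  fixes A :: "complex^'d::finite^'d"
  assumes A: "A \<in> Herm" "simple_eigval A (eigval j A)" and j: "1 \<le> j" "j \<le> CARD('d)"
    and H: "\<And>n. H n \<in> Herm" "H \<longlonglongrightarrow> A"
    and u: "\<And>n. norm (u n) = 1" "\<And>n. H n *v u n = complex_of_real (eigval j (H n)) *s u n"
  shows "(\<lambda>n. outer (u n)) \<longlonglongrightarrow> spec_proj j A"
proof (rule tendsto_compact_unique_limit[OF compact_outer_sphere])
  show "outer (u n) \<in> outer ` sphere 0 1" for n using u by simp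
next
  fix s :: "nat \<Rightarrow> nat" and F
  assume s: "strict_mono s" and F: "((\<lambda>n. outer (u n)) \<circ> s) \<longlonglongrightarrow> F"
  have "closed (outer ` sphere (0 :: complex^'d) 1)"
    using compact_outer_sphere by (rule compact_imp_closed)
  then have "F \<in> outer ` sphere 0 1"
    by (rule closed_sequentially[OF _ _ F]) (use u in simp)
  then obtain f where f: "F = outer f" "norm f = 1" by auto
  have Hs: "(\<lambda>n. H (s n)) \<longlonglongrightarrow> A"
    using LIMSEQ_subseq_LIMSEQ[OF H(2) s] by (simp add: o_def)
  have Fs: "(\<lambda>n. outer (u (s n))) \<longlonglongrightarrow> F" using F by (simp add: o_def)
  have "(\<lambda>n. eigval j (H (s n))) \<longlonglongrightarrow> eigval j A"
    unfolding eigval_def by (rule tendsto_eigvals[OF H(1) Hs]) (use j in simp)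
  then have "(\<lambda>n. complex_of_real (eigval j (H (s n))) *\<^sub>m outer (u (s n)))
      \<longlonglongrightarrow> complex_of_real (eigval j A) *\<^sub>m F"
    by (intro smat_bilinear.tendsto tendsto_of_real Fs)
  moreover have "(\<lambda>n. H (s n) ** outer (u (s n))) \<longlonglongrightarrow> A ** F"
    by (intro matrix_mult.tendsto Hs Fs)
  moreover have "H n ** outer (u n) = complex_of_real (eigval j (H n)) *\<^sub>m outer (u n)" for n
    by (rule mult_outer_eigenvector[OF u(2)])
  ultimately have AF: "A ** F = complex_of_real (eigval j A) *\<^sub>m F"
    by (simp add: LIMSEQ_unique)
  have "outer f *v f = f"
    using f(2) by (simp add: outer_mult_vec herm_self)
  then have "A *v f = (A ** F) *v f"
    by (simp add: f(1) flip: matrix_vector_mul_assoc)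
  also have "\<dots> = complex_of_real (eigval j A) *s f"
  proof -
    have "(c *\<^sub>m M) *v f = c *s (M *v f)" for c M
      by (simp add: vec_eq_iff matrix_vector_mult_def smat_nth sum_distrib_left mult_ac)
    then show ?thesis using \<open>outer f *v f = f\<close> AF by (simp add: f(1))
  qed
  finally show "F = spec_proj j A"
    using simple_spec_proj[OF A(2)] f by metis
qed

text \<open>With \<open>E\<close> and \<open>F\<^sub>n\<close> the eigenprojections of \<open>A\<close> and of the neighbouring matrix \<open>H\<^sub>n\<close>,
  \<open>(\<lambda>(H\<^sub>n) - \<lambda>(A)) E F\<^sub>n = E (H\<^sub>n - A) F\<^sub>n\<close>; take traces, divide, and use \<open>F\<^sub>n \<longlonglongrightarrow> E\<close>.\<close>

lemma eigval_has_real_derivative: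
  fixes H :: "real \<Rightarrow> complex^'d::finite^'d"
  assumes H: "\<And>t. H t \<in> Herm" "(H has_vector_derivative B) (at 0)"
    and simple: "simple_eigval (H 0) (eigval j (H 0))" and j: "1 \<le> j" "j \<le> CARD('d)"
  shows "((\<lambda>t. eigval j (H t)) has_real_derivative Re (trace (spec_proj j (H 0) ** B))) (at 0)"
  unfolding has_field_derivative_iff tendsto_at_iff_sequentially
proof (intro allI impI)
  fix t :: "nat \<Rightarrow> real"
  assume t0: "\<forall>n. t n \<in> UNIV - {0}" and t: "t \<longlonglongrightarrow> 0"
  let ?A = "H 0" and ?l = "\<lambda>t. complex_of_real (eigval j (H t))"
  define E where "E = spec_proj j ?A"
  obtain w where w: "norm w = 1" "?A *v w = ?l 0 *s w" "E = outer w"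
    using simple_spec_proj[OF simple] unfolding E_def by metis
  \<comment> \<open>Eigenvectors are picked independently for each time, with no continuity in
    \<open>s\<close>.\<close>
  have "\<exists>v. norm v = 1 \<and> H s *v v = ?l s *s v" for s
    using eigvals_eigenvector[OF H(1), of "j - 1" s] j unfolding eigval_def
    by (metis One_nat_def Suc_le_eq Suc_pred less_eq_Suc_le)
  then obtain u where u: "\<And>s. norm (u s) = 1" "\<And>s. H s *v u s = ?l s *s u s"
    by metis
  have Ht: "(\<lambda>n. H (t n)) \<longlonglongrightarrow> ?A"
    using has_vector_derivative_continuous[OF H(2)] t
    by (metis continuous_within isCont_tendsto_compose)
  have F: "(\<lambda>n. outer (u (t n))) \<longlonglongrightarrow> E"
    unfolding E_def by (rule tendsto_spec_proj[OF H(1) simple j H(1) Ht u])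
  define D where "D = (\<lambda>n. (1 / t n) *\<^sub>R (H (t n) - ?A))"
  have D: "D \<longlonglongrightarrow> B"
  proof -
    have "((\<lambda>y. norm (H y - H 0 - y *\<^sub>R B) / \<bar>y\<bar>) \<longlongrightarrow> 0) (at 0)"
      using H(2) by (simp add: has_vector_derivative_def has_derivative_iff_norm)
    moreover have "norm (H y - H 0 - y *\<^sub>R B) / \<bar>y\<bar> = norm ((1 / y) *\<^sub>R (H y - H 0) - B)"
      if "y \<noteq> 0" for y
    proof -
      have "(1 / y) *\<^sub>R (H y - H 0) - B = (1 / y) *\<^sub>R (H y - H 0 - y *\<^sub>R B)"
        using that by (simp add: scaleR_diff_right)
      then show ?thesis by (simp add: divide_inverse mult.commute)
    qed
    ultimately have "((\<lambda>y. norm ((1 / y) *\<^sub>R (H y - H 0) - B)) \<longlongrightarrow> 0) (at 0)"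
      by (smt (verit, ccfv_threshold) Lim_cong_within)
    then have "((\<lambda>y. (1 / y) *\<^sub>R (H y - H 0)) \<longlongrightarrow> B) (at 0)"
      by (simp add: Lim_null[of _ B] tendsto_norm_zero_iff)
    then show ?thesis
      using t0 t by (simp add: tendsto_at_iff_sequentially o_def D_def)
  qed
  have EE: "E ** E = E" and trE: "trace E = 1"
    using w by (simp_all add: outer_idem trace_outer)
  \<comment> \<open>\<open>E\<close> acts from the left below, so the eigenvalue equation is
    transposed by taking adjoints; \<open>E\<close> and the matrix are self-adjoint and the
    eigenvalue is real.\<close>
  have EA: "E ** ?A = ?l 0 *\<^sub>m E"
  proof -
    have "?A ** E = ?l 0 *\<^sub>m E" using w by (simp add: mult_outer_eigenvector)
    from arg_cong[OF this, of adj] show ?thesis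
      by (simp add: adj_mult adj_smat HermD[OF H(1)] w(3) adj_outer)
  qed
  have key: "complex_of_real ((eigval j (H (t n)) - eigval j ?A) / t n) * trace (E ** outer (u (t n)))
      = trace (E ** D n ** outer (u (t n)))" for n
  proof -
    let ?F = "outer (u (t n))"
    have "E ** (H (t n) - ?A) ** ?F = E ** (H (t n) ** ?F) - E ** ?A ** ?F"
      by (simp add: matrix_mult.diff_left matrix_mult.diff_right matrix_mul_assoc)
    also have "\<dots> = (?l (t n) - ?l 0) *\<^sub>m (E ** ?F)"
      by (simp add: EA mult_outer_eigenvector[OF u(2)] smat_mult_left smat_mult_right
        smat_bilinear.diff_left)
    finally have *: "E ** (H (t n) - ?A) ** ?F = (?l (t n) - ?l 0) *\<^sub>m (E ** ?F)" .
    show ?thesis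
      by (simp add: D_def matrix_mult.scaleR_left matrix_mult.scaleR_right * trace_smat
         linear_cmul[OF bounded_linear.linear[OF bounded_linear_trace]] scaleR_conv_of_real[where 'a = complex])
  qed
  have lim1: "(\<lambda>n. trace (E ** outer (u (t n)))) \<longlonglongrightarrow> 1"
    using bounded_linear.tendsto[OF bounded_linear_trace matrix_mult.tendsto[OF tendsto_const[of E] F]]
    by (simp add: EE trE)
  have lim2: "(\<lambda>n. trace (E ** D n ** outer (u (t n)))) \<longlonglongrightarrow> trace (E ** B ** E)"
    by (intro bounded_linear.tendsto[OF bounded_linear_trace] matrix_mult.tendsto tendsto_const D F)
  have "trace (E ** B ** E) = trace (E ** B)"
    using trace_mul_sym[of "E ** B" E] by (simp add: matrix_mul_assoc EE)
  with tendsto_divide[OF lim2 lim1]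
  have "(\<lambda>n. trace (E ** D n ** outer (u (t n))) / trace (E ** outer (u (t n)))) \<longlonglongrightarrow> trace (E ** B)"
    by simp
  \<comment> \<open>Dividing by the trace of the product of the projections is legitimate for large
    \<open>n\<close>, since this trace tends to 1.\<close>
  moreover have "\<forall>\<^sub>F n in sequentially. trace (E ** D n ** outer (u (t n))) / trace (E ** outer (u (t n)))
      = complex_of_real ((eigval j (H (t n)) - eigval j ?A) / t n)"
  proof -
    have "\<forall>\<^sub>F n in sequentially. trace (E ** outer (u (t n))) \<noteq> 0"
      using tendsto_imp_eventually_ne[OF lim1, of 0] by simp
    then show ?thesis
      by eventually_elim (metis key nonzero_mult_div_cancel_right)
  qed
  ultimately have "(\<lambda>n. complex_of_real ((eigval j (H (t n)) - eigval j ?A) / t n)) \<longlonglongrightarrow> trace (E ** B)"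
    by (rule Lim_transform_eventually)
  from tendsto_Re[OF this]
  show "((\<lambda>y. (eigval j (H y) - eigval j ?A) / (y - 0)) \<circ> t) \<longlonglongrightarrow> Re (trace (spec_proj j ?A ** B))"
    by (simp add: o_def E_def)
qed

lemma spec_proj_props:
  fixes A :: "complex^'d::finite^'d"
  assumes "A \<in> Herm" "simple_eigval A (eigval j A)"
  defines "E \<equiv> spec_proj j A"
  shows "E ** E = E" "adj E = E" "comm E A = 0"
proof -
  obtain w where w: "norm w = 1" "A *v w = complex_of_real (eigval j A) *s w" "E = outer w"
    using simple_spec_proj[OF assms(2)] unfolding E_def by metis
  show "E ** E = E" "adj E = E" using w by (simp_all add: outer_idem adj_outer)
  have AE: "A ** E = complex_of_real (eigval j A) *\<^sub>m E"
    using w by (simp add: mult_outer_eigenvector)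
  from arg_cong[OF this, of adj]
  have "E ** A = complex_of_real (eigval j A) *\<^sub>m E"
    using assms(1) by (simp add: adj_mult adj_smat HermD w(3) adj_outer)
  with AE show "comm E A = 0" by (simp add: comm_def)
qed

subsection \<open>The exponential of a multiple of a projection\<close>

text \<open>Every positive power of c E is c^k E, so the series is the scalar exponential series
  times \<open>E\<close>, apart from its constant term.\<close>

lemma mexp_idem:
  fixes E :: "complex^'d::finite^'d"
  assumes E: "E ** E = E"
  shows "mexp (c *\<^sub>m E) = mat 1 + (exp c - 1) *\<^sub>m E"
proof -
  \<comment> \<open>The power with \<open>k = 0\<close> is the identity instead of \<open>E\<close>;
    the summand \<open>mat 1 - E\<close> corrects for this.\<close>
  have pow: "mpow (c *\<^sub>m E) k = (if k = 0 then mat 1 - E else 0) + c ^ k *\<^sub>m E" for k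
  proof (induction k)
    case 0
    show ?case by (simp add: mpow_def smat_one)
  next
    case (Suc k)
    have "mpow (c *\<^sub>m E) (Suc k) = (c *\<^sub>m E) ** mpow (c *\<^sub>m E) k"
      by (simp add: mpow_def)
    also have "\<dots> = c ^ Suc k *\<^sub>m E"
      by (simp add: Suc.IH matrix_mult.add_right matrix_mult.diff_right smat_mult_left
          smat_mult_right smat_assoc E matrix_mult.zero_right smat_bilinear.zero_right mult.commute)
    finally show ?case by simp
  qed
  have "(\<lambda>k. if k = 0 then mat 1 - E else 0) sums (mat 1 - E)"
    using sums_single[of 0 "\<lambda>_. mat 1 - E"] by (simp add: eq_commute cong: if_cong)
  moreover have "(\<lambda>k. (c ^ k /\<^sub>R fact k) *\<^sub>m E) sums (exp c *\<^sub>m E)"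
    by (rule bounded_linear.sums[OF smat_bilinear.bounded_linear_left exp_converges])
  ultimately have "(\<lambda>k. (if k = 0 then mat 1 - E else 0) + (c ^ k /\<^sub>R fact k) *\<^sub>m E)
      sums (mat 1 - E + exp c *\<^sub>m E)"
    by (rule sums_add)
  also have "(\<lambda>k. (if k = 0 then mat 1 - E else 0) + (c ^ k /\<^sub>R fact k) *\<^sub>m E) =
      (\<lambda>k. (1 / fact k) *\<^sub>R mpow (c *\<^sub>m E) k)"
    by (rule ext) (auto simp: pow scaleR_add_right smat_bilinear.scaleR_left divide_inverse)
  finally have "mexp (c *\<^sub>m E) = mat 1 - E + exp c *\<^sub>m E"
    by (simp add: mexp_def sums_iff)
  then show ?thesis by (simp add: smat_bilinear.diff_left smat_one)
qed

lemma mexp_zero: "mexp (0 *\<^sub>m E) = mat 1" for E :: "complex^'d::finite^'d"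
  using mexp_idem[of 0 0] by (simp add: smat_bilinear.zero_left matrix_mult.zero_left)

lemma mexp_idem_add:
  fixes E :: "complex^'d::finite^'d"
  assumes "E ** E = E"
  shows "mexp (c *\<^sub>m E) ** mexp (d *\<^sub>m E) = mexp ((c + d) *\<^sub>m E)"
proof -
  have "mexp (c *\<^sub>m E) ** mexp (d *\<^sub>m E) =
      mat 1 + ((exp d - 1) *\<^sub>m E + ((exp c - 1) *\<^sub>m E + ((exp c - 1) * (exp d - 1)) *\<^sub>m E))"
    by (simp add: mexp_idem[OF assms] matrix_mult.add_left matrix_mult.add_right smat_mult_left
        smat_mult_right smat_bilinear.add_right smat_assoc assms mult.commute)
  also have "(exp d - 1) *\<^sub>m E + ((exp c - 1) *\<^sub>m E + ((exp c - 1) * (exp d - 1)) *\<^sub>m E) =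
      (exp (c + d) - 1) *\<^sub>m E"
    by (simp add: exp_add algebra_simps flip: smat_bilinear.add_left)
  finally show ?thesis by (simp add: mexp_idem[OF assms])
qed

lemma mexp_idem_inverse:
  fixes E :: "complex^'d::finite^'d"
  assumes "E ** E = E" "c + d = 0"
  shows "mexp (c *\<^sub>m E) ** mexp (d *\<^sub>m E) = mat 1"
  by (simp add: mexp_idem_add assms mexp_zero)

lemma mexp_idem_commute:
  fixes E A :: "complex^'d::finite^'d"
  assumes "E ** E = E" "comm E A = 0"
  shows "mexp (c *\<^sub>m E) ** A = A ** mexp (c *\<^sub>m E)"
  using assms by (simp add: mexp_idem comm_def matrix_mult.add_left matrix_mult.add_right
      smat_mult_left smat_mult_right)

lemma adj_mexp_idem:
  fixes E :: "complex^'d::finite^'d"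
  assumes "E ** E = E" "adj E = E"
  shows "adj (mexp (c *\<^sub>m E)) = mexp (cnj c *\<^sub>m E)"
  using assms by (simp add: mexp_idem linear_add[OF linear_adj] adj_smat adj_mat_1 exp_cnj)

lemma has_vector_derivative_mexp_idem:
  fixes E :: "complex^'d::finite^'d"
  assumes "E ** E = E"
  shows "((\<lambda>t. mexp ((c * complex_of_real t) *\<^sub>m E)) has_vector_derivative
    c *\<^sub>m E ** mexp ((c * complex_of_real t) *\<^sub>m E)) (at t within S)"
proof -
  have "((\<lambda>z. exp (c * z) - 1) has_field_derivative c * exp (c * of_real t)) (at (of_real t))"
    by (auto intro!: derivative_eq_intros)
  then have "((\<lambda>t. exp (c * complex_of_real t) - 1) has_vector_derivative c * exp (c * of_real t)) (at t within S)"
    by (rule has_vector_derivative_real_field)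
  from bounded_linear.has_vector_derivative[OF smat_bilinear.bounded_linear_left[of E] this]
  have "((\<lambda>t. mat 1 + (exp (c * complex_of_real t) - 1) *\<^sub>m E) has_vector_derivative
      (c * exp (c * of_real t)) *\<^sub>m E) (at t within S)"
    by (auto intro!: derivative_eq_intros)
  moreover have "c *\<^sub>m E ** mexp ((c * complex_of_real t) *\<^sub>m E) = (c * exp (c * of_real t)) *\<^sub>m E"
    by (simp add: mexp_idem assms matrix_mult.add_right smat_mult_left smat_mult_right
        matrix_mult.diff_right smat_bilinear.diff_left smat_bilinear.diff_right smat_assoc smat_one mult.commute)
  ultimately show ?thesis by (simp add: mexp_idem assms)
qed

text \<open>Product rule, with \<open>E\<close> moved through its own exponential. A constant
  \<open>X\<close> shows that conjugation solves the system; a solution \<open>X\<close>, with the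
  sign of \<open>c\<close> reversed, gives derivative zero and hence uniqueness.\<close>

lemma has_vector_derivative_conjugate:
  fixes E :: "complex^'d::finite^'d"
  assumes E: "E ** E = E" and X: "(X has_vector_derivative X') (at t within S)"
  shows "((\<lambda>t. mexp ((c * complex_of_real t) *\<^sub>m E) ** X t ** mexp ((- c * complex_of_real t) *\<^sub>m E))
    has_vector_derivative
      mexp ((c * complex_of_real t) *\<^sub>m E) ** (X' + c *\<^sub>m comm E (X t))
        ** mexp ((- c * complex_of_real t) *\<^sub>m E)) (at t within S)"
proof -
  let ?P = "mexp ((c * complex_of_real t) *\<^sub>m E)" and ?Q = "mexp ((- c * complex_of_real t) *\<^sub>m E)"
  have PE: "E ** ?P = ?P ** E"
    using mexp_idem_commute[OF E, of E "c * complex_of_real t"] by (simp add: comm_def)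
  have "((\<lambda>t. mexp ((c * complex_of_real t) *\<^sub>m E) ** X t ** mexp ((- c * complex_of_real t) *\<^sub>m E))
    has_vector_derivative
      ?P ** X t ** (- c *\<^sub>m E ** ?Q) + (?P ** X' + (c *\<^sub>m E ** ?P) ** X t) ** ?Q) (at t within S)"
    by (intro matrix_mult.has_vector_derivative has_vector_derivative_mexp_idem E X)
  also have "?P ** X t ** (- c *\<^sub>m E ** ?Q) + (?P ** X' + (c *\<^sub>m E ** ?P) ** X t) ** ?Q =
      ?P ** (X' + c *\<^sub>m comm E (X t)) ** ?Q"
    by (simp add: comm_def PE matrix_mult.add_left matrix_mult.add_right matrix_mult.diff_left
        matrix_mult.diff_right smat_mult_left smat_mult_right matrix_mul_assoc
        smat_bilinear.diff_right smat_bilinear.minus_left matrix_mult.minus_left matrix_mult.minus_right)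
  finally show ?thesis .
qed

subsection \<open>Orbits\<close>

lemma orbit_in_Herm: "X \<in> orbit r \<Longrightarrow> X \<in> Herm"
  using subspace_scale[OF subspace_Herm outer_in_Herm] by (auto simp: orbit_def)

lemma orbit_square: "X \<in> orbit r \<Longrightarrow> X ** X = r *\<^sub>R X"
  by (auto simp: orbit_def matrix_mult.scaleR_left matrix_mult.scaleR_right outer_idem)

text \<open>An isometry sends the unit vector \<open>w\<close> to the unit vector
  \<open>P *v w\<close>, and conjugating \<open>outer w\<close> gives
  \<open>outer (P *v w)\<close>.\<close>

lemma unitary_conjugate_orbit:
  fixes X :: "complex^'d::finite^'d"
  assumes "X \<in> orbit r" "adj P ** P = mat 1"
  shows "P ** X ** adj P \<in> orbit r"
proof -
  obtain w where w: "X = r *\<^sub>R outer w" "norm w = 1" using assms(1) by (auto simp: orbit_def)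
  have "herm (P *v w) (P *v w) = herm w w"
    by (simp add: herm_mult_adj matrix_vector_mul_assoc assms(2))
  then have "complex_of_real ((norm (P *v w))\<^sup>2) = 1"
    unfolding herm_self w(2) by simp
  then have "norm (P *v w) = 1"
    by (simp only: of_real_eq_1_iff power2_eq_1_iff) (smt (verit) norm_ge_zero)
  moreover have "P ** X ** adj P = r *\<^sub>R outer (P *v w)"
    by (simp add: w(1) matrix_mult.scaleR_left matrix_mult.scaleR_right mult_outer_adj)
  ultimately show ?thesis by (auto simp: orbit_def)
qed

text \<open>Differentiating \<open>X\<^sup>2 = r X\<close> gives \<open>W X + X W = r W\<close>, whence \<open>X W X = 0\<close> and
  \<open>[[W, X], X] = r\<^sup>2 W\<close>.\<close>

lemma orbit_velocity_tangent:
  fixes \<gamma> :: "real \<Rightarrow> complex^'d::finite^'d"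
  assumes r: "r \<noteq> 0" and \<gamma>: "\<And>t. \<gamma> t \<in> orbit r" and W: "(\<gamma> has_vector_derivative W) (at 0)"
  shows "W \<in> tangent (\<gamma> 0)"
proof -
  define X where "X = \<gamma> 0"
  have X: "X ** X = r *\<^sub>R X" "adj X = X"
    using orbit_square[OF \<gamma>] HermD[OF orbit_in_Herm[OF \<gamma>]] by (auto simp: X_def)
  \<comment> \<open>The curve consists of Hermitian matrices, so its velocity is Hermitian as well;
    this later makes \<open>comm W X\<close> skew-Hermitian.\<close>
  have "((\<lambda>t. adj (\<gamma> t)) has_vector_derivative adj W) (at 0)"
    by (rule bounded_linear.has_vector_derivative[OF _ W]) (simp add: linear_adj flip: linear_conv_bounded_linear)
  then have "(\<gamma> has_vector_derivative adj W) (at 0)"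
    by (simp add: HermD[OF orbit_in_Herm[OF \<gamma>]])
  then have adjW: "adj W = W"
    using W vector_derivative_at by metis
  have "((\<lambda>t. \<gamma> t ** \<gamma> t) has_vector_derivative X ** W + W ** X) (at 0)"
    unfolding X_def by (rule matrix_mult.has_vector_derivative[OF W W])
  moreover have "((\<lambda>t. r *\<^sub>R \<gamma> t) has_vector_derivative r *\<^sub>R W) (at 0)"
    by (rule bounded_linear.has_vector_derivative[OF bounded_linear_scaleR_right W])
  ultimately have rW: "X ** W + W ** X = r *\<^sub>R W"
    using vector_derivative_at by (metis (no_types, lifting) ext orbit_square[OF \<gamma>])
  let ?Z = "X ** W ** X"
  \<comment> \<open>Sandwiching the differentiated relation between two copies of \<open>X\<close>
    gives 2 r Z on one side and r Z on the other, so Z = 0.\<close>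
  have "X ** (X ** W + W ** X) ** X = r *\<^sub>R ?Z + r *\<^sub>R ?Z"
    by (simp add: matrix_mult.add_left matrix_mult.add_right matrix_mul_assoc X(1) matrix_mult.scaleR_left)
       (simp add: X(1) matrix_mult.scaleR_right flip: matrix_mul_assoc)
  moreover have "X ** (X ** W + W ** X) ** X = r *\<^sub>R ?Z"
    by (simp add: rW matrix_mult.scaleR_left matrix_mult.scaleR_right)
  ultimately have Z: "?Z = 0" using r by simp
  have "comm (comm W X) X = W ** (X ** X) - ?Z - ?Z + (X ** X) ** W"
    by (simp add: comm_def matrix_mult.diff_left matrix_mult.diff_right matrix_mul_assoc)
  also have "\<dots> = r *\<^sub>R (X ** W + W ** X)"
    by (simp add: Z X(1) matrix_mult.scaleR_left matrix_mult.scaleR_right scaleR_add_right)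
  finally have "comm (comm W X) X = (r * r) *\<^sub>R W" by (simp add: rW)
  then have "comm ((1 / (r * r)) *\<^sub>R comm W X) X = W"
    using r by (simp add: comm_smat_left flip: smat_of_real) (simp add: smat_assoc smat_one)
  moreover have "(1 / (r * r)) *\<^sub>R comm W X \<in> u_alg"
    by (simp add: u_alg_def comm_def linear_cmul[OF linear_adj] linear_diff[OF linear_adj] adj_mult X(2) adjW
        scaleR_diff_right)
  ultimately show ?thesis unfolding tangent_def X_def by (metis (mono_tags, lifting) mem_Collect_eq)
qed

subsection \<open>The Hamiltonian flow\<close>

lemma N_tilde_in_orbit: "e \<in> N_tilde n r \<Longrightarrow> k \<in> {1..n} \<Longrightarrow> e k \<in> orbit (r k)"
  by (auto simp: N_tilde_def)

lemma psum_Herm: "(\<And>k. k \<in> {1..i + 1} \<Longrightarrow> e k \<in> Herm) \<Longrightarrow> psum i e \<in> Herm"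
  unfolding psum_def by (intro subspace_sum[OF subspace_Herm]) auto

lemma psum_N_tilde_Herm: "e \<in> N_tilde n r \<Longrightarrow> i + 1 \<le> n \<Longrightarrow> psum i e \<in> Herm"
  by (intro psum_Herm orbit_in_Herm[OF N_tilde_in_orbit[of e n r]]) auto

lemma openin_simple_locus:
  assumes "i + 1 \<le> n" "1 \<le> j" "j \<le> CARD('d)"
  shows "openin (product_topology (\<lambda>k. top_of_set (orbit (r k))) {1..n})
    (simple_locus n r i j :: 'd::finite tuple set)"
proof -
  let ?T = "product_topology (\<lambda>k. top_of_set (orbit (r k) :: (complex^'d^'d) set)) {1..n}"
  have top: "topspace ?T = N_tilde n r" by (simp add: N_tilde_def)
  have "continuous_map ?T euclidean (\<lambda>e. e k)" if "k \<in> {1..i + 1}" for k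
    using continuous_map_product_projection[of k "{1..n}" "\<lambda>k. top_of_set (orbit (r k))"] that assms(1)
    by (auto intro: continuous_map_into_fulltopology)
  then have "continuous_map ?T euclidean (psum i)"
    unfolding psum_def by (intro continuous_map_sum) auto
  then have "continuous_map ?T (top_of_set Herm) (psum i)"
    unfolding continuous_map_in_subtopology top using psum_N_tilde_Herm[OF _ assms(1)] by auto
  from openin_continuous_map_preimage[OF this openin_simple_eigval[OF assms(2,3)]]
  show ?thesis
    unfolding top simple_locus_def lam_def
    by (rule back_subst[of "openin ?T"]) (use psum_N_tilde_Herm[OF _ assms(1)] in blast)
qed

text \<open>Translates between the pairing with the gradient candidate and the derivative formula of
  a simple eigenvalue. The slots beyond \<open>i + 1\<close> contribute nothing.\<close>

lemma sum_Im_trace_proj: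
  fixes E :: "complex^'d::finite^'d"
  assumes "i + 1 \<le> n"
  shows "(\<Sum>k=1..n. Im (trace ((if 1 \<le> k \<and> k \<le> i + 1 then \<i> *\<^sub>m E else 0) ** Y k))) =
    Re (trace (E ** psum i Y))"
proof -
  have "(\<Sum>k=1..n. Im (trace ((if 1 \<le> k \<and> k \<le> i + 1 then \<i> *\<^sub>m E else 0) ** Y k))) =
      (\<Sum>k=1..i+1. Re (trace (E ** Y k)))"
    using assms
    by (intro sum.mono_neutral_cong_right)
      (auto simp: smat_mult_left trace_smat matrix_mult.zero_left linear_0[OF bounded_linear.linear[OF bounded_linear_trace]])
  also have "\<dots> = Re (trace (E ** psum i Y))"
    by (simp only: psum_def matrix_mult.sum_right linear_sum[OF bounded_linear.linear[OF bounded_linear_trace]] Re_sum)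
  finally show ?thesis .
qed

lemma comm_sum_right: "comm A (sum f S) = (\<Sum>k\<in>S. comm A (f k))"
  by (simp add: comm_def matrix_mult.sum_left matrix_mult.sum_right sum_subtractf)

text \<open>The derivative formula is used along straight lines of Hermitian matrices for the
  gradient, and along curves in the orbits for the symplectic form.\<close>

lemma lam_is_hamiltonian:
  assumes r: "\<And>k. k \<in> {1..n} \<Longrightarrow> r k > 0" and i: "i + 1 \<le> n"
    and j: "1 \<le> j" "j \<le> CARD('d)"
  shows "is_hamiltonian n r (simple_locus n r i j :: 'd::finite tuple set) (lam i j)
    (\<lambda>e k. if 1 \<le> k \<and> k \<le> i + 1 then \<i> *\<^sub>m comm (spec_proj j (psum i e)) (e k) else 0)"
  unfolding is_hamiltonian_def
proof (intro ballI)
  fix e :: "'d tuple"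
  assume "e \<in> simple_locus n r i j"
  then have e: "e \<in> N_tilde n r" and simple: "simple_eigval (psum i e) (eigval j (psum i e))"
    by (auto simp: simple_locus_def lam_def)
  let ?A = "psum i e"
  define E where "E = spec_proj j ?A"
  define \<xi> where "\<xi> k = (if 1 \<le> k \<and> k \<le> i + 1 then \<i> *\<^sub>m E else 0)" for k
  define V where "V k = (if 1 \<le> k \<and> k \<le> i + 1 then \<i> *\<^sub>m comm E (e k) else 0)" for k
  have A: "?A \<in> Herm" by (rule psum_N_tilde_Herm[OF e i])
  have \<xi>: "\<xi> k \<in> u_alg" for k
    using spec_proj_props(2)[OF A simple]
    by (simp add: \<xi>_def u_alg_def adj_smat E_def linear_0[OF linear_adj] smat_bilinear.minus_left)
  have V: "V k = comm (\<xi> k) (e k)" for k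
    by (simp add: V_def \<xi>_def comm_smat_left) (simp add: comm_def matrix_mult.zero_left matrix_mult.zero_right)
  have grad: "is_gradient n (lam i j) e \<xi>"
    unfolding is_gradient_def
  proof (intro conjI ballI allI impI \<xi>)
    fix Y :: "'d tuple"
    assume Y: "\<forall>k\<in>{1..n}. Y k \<in> Herm"
    have psum: "psum i (\<lambda>k\<in>{1..n}. e k + t *\<^sub>R Y k) = ?A + t *\<^sub>R psum i Y" for t
      using i by (simp add: psum_def sum.distrib scaleR_sum_right scaleR_add_right)
    have "((\<lambda>t. eigval j (?A + t *\<^sub>R psum i Y)) has_real_derivative Re (trace (spec_proj j (?A + 0 *\<^sub>R psum i Y) ** psum i Y))) (at 0)"
    proof (rule eigval_has_real_derivative[OF _ _ _ j])
      have "psum i Y \<in> Herm" using Y i by (intro psum_Herm) auto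
      then show "?A + t *\<^sub>R psum i Y \<in> Herm" for t
        by (intro subspace_add[OF subspace_Herm] subspace_scale[OF subspace_Herm] A)
      show "((\<lambda>t. ?A + t *\<^sub>R psum i Y) has_vector_derivative psum i Y) (at 0)"
        by (auto intro!: derivative_eq_intros)
    qed (simp add: simple)
    then show "((\<lambda>t. lam i j (\<lambda>k\<in>{1..n}. e k + t *\<^sub>R Y k)) has_real_derivative
        (\<Sum>k=1..n. Im (trace (\<xi> k ** Y k)))) (at 0)"
      by (simp only: lam_def psum \<xi>_def sum_Im_trace_proj[OF i]) (simp add: E_def)
  qed
  have flow: "((\<lambda>t. lam i j (\<gamma> t)) has_real_derivative prod_form n e V W) (at 0)"
    if \<gamma>: "\<And>t. \<gamma> t \<in> N_tilde n r" "\<gamma> 0 = e"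
      and W: "\<And>k. k \<in> {1..n} \<Longrightarrow> ((\<lambda>t. \<gamma> t k) has_vector_derivative W k) (at 0)" for \<gamma> W
  proof -
    \<comment> \<open>Positivity of \<open>r k\<close> makes the velocity tangent, say [\<eta>, e];
      cyclicity of the trace then turns the form on [\<xi>, e] and [\<eta>, e] into the pairing of
      \<xi> with the velocity.\<close>
    have kk: "kk_form (e k) (V k) (W k) = Im (trace (\<xi> k ** W k))" if k: "k \<in> {1..n}" for k
    proof -
      have "W k \<in> tangent (e k)"
        using orbit_velocity_tangent[OF _ N_tilde_in_orbit[OF \<gamma>(1) k] W[OF k]] r[OF k] \<gamma>(2) by simp
      then obtain \<eta> where \<eta>: "\<eta> \<in> u_alg" "W k = comm \<eta> (e k)"
        by (auto simp: tangent_def)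
      then show ?thesis
        by (simp add: V kk_form_comm[OF \<xi>] trace_comm_right)
    qed
    have "((\<lambda>t. eigval j (psum i (\<gamma> t))) has_real_derivative
        Re (trace (spec_proj j (psum i (\<gamma> 0)) ** psum i W))) (at 0)"
    proof (rule eigval_has_real_derivative[OF _ _ _ j])
      show "psum i (\<gamma> t) \<in> Herm" for t by (rule psum_N_tilde_Herm[OF \<gamma>(1) i])
      show "((\<lambda>t. psum i (\<gamma> t)) has_vector_derivative psum i W) (at 0)"
        unfolding psum_def using W i by (intro has_vector_derivative_sum) auto
    qed (simp add: \<gamma>(2) simple)
    moreover have "prod_form n e V W = Re (trace (E ** psum i W))"
      unfolding prod_form_def using kk sum_Im_trace_proj[OF i, of E W] by (simp add: \<xi>_def)
    ultimately show ?thesis by (simp add: lam_def \<gamma>(2) E_def)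
  qed
  have tangent: "V k \<in> tangent (e k)" for k
    unfolding V tangent_def using \<xi> by blast
  show "(\<exists>\<xi>. is_gradient n (lam i j) e \<xi> \<and>
      (\<forall>k\<in>{1..n}. (if 1 \<le> k \<and> k \<le> i + 1 then \<i> *\<^sub>m comm (spec_proj j ?A) (e k) else 0) = comm (\<xi> k) (e k))) \<and>
    (\<forall>k\<in>{1..n}. (if 1 \<le> k \<and> k \<le> i + 1 then \<i> *\<^sub>m comm (spec_proj j ?A) (e k) else 0) \<in> tangent (e k)) \<and>
    (\<forall>\<gamma> W. (\<forall>t. \<gamma> t \<in> N_tilde n r) \<and> \<gamma> 0 = e \<and>
        (\<forall>k\<in>{1..n}. ((\<lambda>t. \<gamma> t k) has_vector_derivative W k) (at 0)) \<longrightarrow>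
      ((\<lambda>t. lam i j (\<gamma> t)) has_real_derivative
        prod_form n e (\<lambda>k. if 1 \<le> k \<and> k \<le> i + 1 then \<i> *\<^sub>m comm (spec_proj j ?A) (e k) else 0) W) (at 0))"
    unfolding E_def[symmetric] V_def[symmetric] using grad V tangent flow by blast
qed

lemma lam_is_flow:
  assumes i: "i + 1 \<le> n"
  shows "is_flow n (simple_locus n r i j :: 'd::finite tuple set)
    (\<lambda>e k. if 1 \<le> k \<and> k \<le> i + 1 then \<i> *\<^sub>m comm (spec_proj j (psum i e)) (e k) else 0)
    (\<lambda>t e k. if 1 \<le> k \<and> k \<le> i + 1
      then mexp ((\<i> * complex_of_real t) *\<^sub>m spec_proj j (psum i e)) ** e k
        ** mexp ((- \<i> * complex_of_real t) *\<^sub>m spec_proj j (psum i e)) else e k)"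
    (is "is_flow n ?U ?V ?\<phi>")
  unfolding is_flow_def
proof (intro ballI)
  fix e :: "'d tuple"
  assume eU: "e \<in> ?U"
  then have e: "e \<in> N_tilde n r" and simple: "simple_eigval (psum i e) (eigval j (psum i e))"
    by (auto simp: simple_locus_def lam_def)
  let ?A = "psum i e"
  define E where "E = spec_proj j ?A"
  have A: "?A \<in> Herm" by (rule psum_N_tilde_Herm[OF e i])
  have E: "E ** E = E" "adj E = E" "comm E ?A = 0"
    using spec_proj_props[OF A simple] by (simp_all add: E_def)
  define P where "P t = mexp ((\<i> * complex_of_real t) *\<^sub>m E)" for t
  define Q where "Q t = mexp ((- \<i> * complex_of_real t) *\<^sub>m E)" for t
  have PQ: "P t ** Q t = mat 1" "Q t ** P t = mat 1" "adj (P t) = Q t" for t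
    by (simp_all add: P_def Q_def mexp_idem_inverse[OF E(1)] adj_mexp_idem[OF E(1,2)])
  define \<Phi> where "\<Phi> t = (\<lambda>k. if 1 \<le> k \<and> k \<le> i + 1
      then mexp ((\<i> * complex_of_real t) *\<^sub>m spec_proj j (psum i e)) ** e k
        ** mexp ((- \<i> * complex_of_real t) *\<^sub>m spec_proj j (psum i e)) else e k)" for t
  have \<phi>: "\<Phi> t k = (if 1 \<le> k \<and> k \<le> i + 1 then P t ** e k ** Q t else e k)" for t k
    by (simp add: \<Phi>_def P_def Q_def E_def)
  \<comment> \<open>Conjugation by \<open>P t\<close> fixes \<open>psum i e\<close>, since
    \<open>E\<close> commutes with it. Hence the spectral projection is the same along the curve and
    the eigenvalue stays simple, so the curve never leaves the locus.\<close>
  have psum: "psum i (\<Phi> t) = ?A" for t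
  proof -
    have "psum i (\<Phi> t) = P t ** ?A ** Q t"
    proof -
      have "psum i (\<Phi> t) = (\<Sum>k=1..i+1. P t ** e k ** Q t)"
        unfolding psum_def[of i "\<Phi> t"]
        by (intro sum.cong refl) (auto simp: \<phi>)
      then show ?thesis
        by (simp only: psum_def[of i e] matrix_mult.sum_left matrix_mult.sum_right)
    qed
    also have "\<dots> = ?A ** (P t ** Q t)"
      using mexp_idem_commute[OF E(1,3)] by (simp add: P_def matrix_mul_assoc)
    finally show ?thesis by (simp add: PQ)
  qed
  have "\<Phi> t \<in> N_tilde n r" for t
    unfolding N_tilde_def
  proof (rule PiE_I)
    fix k assume k: "k \<in> {1..n}"
    show "\<Phi> t k \<in> orbit (r k)"
      unfolding \<phi>
      using unitary_conjugate_orbit[OF N_tilde_in_orbit[OF e k], of "P t"] N_tilde_in_orbit[OF e k]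
      by (simp add: PQ)
  next
    \<comment> \<open>The conjugated slots all lie in \<open>{1..n}\<close> because
      \<open>i + 1 \<le> n\<close>, so the value \<open>undefined\<close> outside is
      preserved.\<close>
    fix k assume "k \<notin> {1..n}"
    then show "\<Phi> t k = undefined"
      using i e by (auto simp: \<phi> N_tilde_def PiE_def extensional_def)
  qed
  then have \<phi>U: "\<Phi> t \<in> ?U" for t
    using simple by (simp add: simple_locus_def lam_def psum)
  have zero: "\<Phi> 0 = e"
    by (rule ext) (simp add: \<phi> P_def Q_def mexp_zero)
  have "is_solution n ?U ?V UNIV (\<lambda>t. \<Phi> t)"
    unfolding is_solution_def
  proof (intro ballI conjI \<phi>U)
    fix t k assume k: "k \<in> {1..n}"
    show "((\<lambda>s. \<Phi> s k) has_vector_derivative ?V (\<Phi> t) k) (at t within UNIV)"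
    proof (cases "k \<le> i + 1")
      case True
      have "comm E (P t) = 0" "comm E (Q t) = 0"
        using mexp_idem_commute[OF E(1), of E] by (simp_all add: P_def Q_def comm_def)
      then have EP: "E ** P t = P t ** E" "E ** Q t = Q t ** E" by (simp_all add: comm_def)
      have "((\<lambda>s. P s ** e k ** Q s) has_vector_derivative P t ** (0 + \<i> *\<^sub>m comm E (e k)) ** Q t) (at t)"
        unfolding P_def Q_def by (rule has_vector_derivative_conjugate[OF E(1) has_vector_derivative_const])
      also have "P t ** (0 + \<i> *\<^sub>m comm E (e k)) ** Q t = \<i> *\<^sub>m comm E (P t ** e k ** Q t)"
        by (simp add: comm_def matrix_mult.diff_left matrix_mult.diff_right smat_mult_left smat_mult_right
           matrix_mul_assoc EP(1)) (simp add: EP(2) flip: matrix_mul_assoc)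
      finally show ?thesis using True k by (simp add: psum \<phi> flip: E_def)
    next
      case False
      then show ?thesis by (simp add: \<phi>)
    qed
  qed
  moreover have "\<gamma> t = \<Phi> t"
    if T: "is_interval T" "0 \<in> T" and sol: "is_solution n ?U ?V T \<gamma>" and \<gamma>0: "\<gamma> 0 = e" and t: "t \<in> T"
    for T \<gamma> t
  proof -
    have conv: "convex T" using T(1) by (rule is_interval_convex)
    have \<gamma>U: "\<gamma> s \<in> N_tilde n r" "simple_eigval (psum i (\<gamma> s)) (eigval j (psum i (\<gamma> s)))" if "s \<in> T" for s
      using sol that by (auto simp: is_solution_def simple_locus_def lam_def)
    have deriv: "((\<lambda>s. \<gamma> s k) has_vector_derivative ?V (\<gamma> s) k) (at s within T)" if "s \<in> T" "k \<in> {1..n}" for s k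
      using sol that by (auto simp: is_solution_def)
    \<comment> \<open>For an arbitrary solution the spectral projection might vary with
      \<open>s\<close>; at each time it still commutes with the current partial sum, and this
      suffices to freeze that sum.\<close>
    have "((\<lambda>s. psum i (\<gamma> s)) has_vector_derivative 0) (at s within T)" if s: "s \<in> T" for s
    proof -
      let ?F = "spec_proj j (psum i (\<gamma> s))"
      have "((\<lambda>s. psum i (\<gamma> s)) has_vector_derivative (\<Sum>k=1..i+1. ?V (\<gamma> s) k)) (at s within T)"
        unfolding psum_def by (intro has_vector_derivative_sum deriv[unfolded psum_def] s) (use i in auto)
      also have "(\<Sum>k=1..i+1. ?V (\<gamma> s) k) = (\<Sum>k=1..i+1. \<i> *\<^sub>m comm ?F (\<gamma> s k))"
        by (intro sum.cong) auto
      also have "\<dots> = \<i> *\<^sub>m comm ?F (psum i (\<gamma> s))"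
        by (simp only: psum_def comm_sum_right smat_bilinear.sum_right)
      also have "\<dots> = 0"
        using spec_proj_props(3)[OF psum_N_tilde_Herm[OF \<gamma>U(1)[OF s] i] \<gamma>U(2)[OF s]]
        by (simp add: smat_bilinear.zero_right)
      finally show ?thesis .
    qed
    from has_vector_derivative_zero_constant[OF conv this]
    have psum_const: "psum i (\<gamma> s) = ?A" if "s \<in> T" for s
      using that T(2) \<gamma>0 by metis
    have "\<gamma> t k = \<Phi> t k" for k
    proof -
      consider "1 \<le> k" "k \<le> i + 1" | "i + 1 < k" "k \<le> n" | "k \<notin> {1..n}"
        by force
      then show ?thesis
      proof cases
        case 1
        then have k: "k \<in> {1..n}" using i by auto
        \<comment> \<open>The expected motion is undone by the inverse conjugation; what remains is
          constant on the interval and equals the initial matrix \<open>e k\<close>.\<close>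
        have "((\<lambda>s. Q s ** \<gamma> s k ** P s) has_vector_derivative 0) (at s within T)" if s: "s \<in> T" for s
        proof -
          have "((\<lambda>s. \<gamma> s k) has_vector_derivative \<i> *\<^sub>m comm E (\<gamma> s k)) (at s within T)"
            using deriv[OF s k] 1 by (simp add: psum_const[OF s] E_def)
          from has_vector_derivative_conjugate[OF E(1) this, of "- \<i>"]
          show ?thesis
            by (simp add: P_def Q_def smat_bilinear.minus_left matrix_mult.zero_left matrix_mult.zero_right)
        qed
        from has_vector_derivative_zero_constant[OF conv this]
        have "Q t ** \<gamma> t k ** P t = Q 0 ** \<gamma> 0 k ** P 0"
          using t T(2) by metis
        then have "Q t ** \<gamma> t k ** P t = e k"
          by (simp add: \<gamma>0 P_def Q_def mexp_zero)
        then have "P t ** e k ** Q t = (P t ** Q t) ** \<gamma> t k ** (P t ** Q t)"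
          by (metis matrix_mul_assoc)
        then show ?thesis using 1 by (simp add: \<phi> PQ)
      next
        case 2
        then have k: "k \<in> {1..n}" by auto
        have "((\<lambda>s. \<gamma> s k) has_vector_derivative 0) (at s within T)" if "s \<in> T" for s
          using deriv[OF that k] 2 by simp
        from has_vector_derivative_zero_constant[OF conv this]
        have "\<gamma> t k = \<gamma> 0 k" using t T(2) by metis
        then show ?thesis using 2 \<gamma>0 by (simp add: \<phi>)
      next
        case 3
        then have "\<gamma> t k = undefined" "e k = undefined"
          using \<gamma>U(1)[OF t] e by (auto simp: N_tilde_def PiE_def extensional_def)
        then show ?thesis using 3 i by (auto simp: \<phi>)
      qed
    qed
    then show ?thesis by (rule ext)
  qed
  ultimately show "?\<phi> 0 e = e \<and> is_solution n ?U ?V UNIV (\<lambda>t. ?\<phi> t e) \<and>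
     (\<forall>T \<gamma>. is_interval T \<and> 0 \<in> T \<and> is_solution n ?U ?V T \<gamma> \<and> \<gamma> 0 = e \<longrightarrow>
        (\<forall>t\<in>T. \<gamma> t = ?\<phi> t e))"
    unfolding \<Phi>_def[symmetric] using zero by blast
qed

theorem proposition5p1p3:
  fixes m n i j :: nat and r :: "nat \<Rightarrow> real"
    and U :: "'d::finite tuple set"
    and V :: "'d tuple \<Rightarrow> 'd tuple"
    and \<phi> :: "real \<Rightarrow> 'd tuple \<Rightarrow> 'd tuple"
  assumes "CARD('d) = m + 1" and "m \<ge> 1" and "n \<ge> 4"
    and "\<And>k. k \<in> {1..n} \<Longrightarrow> r k > 0"
    and "1 \<le> i" and "i \<le> n - 3" and "1 \<le> j" and "j \<le> m + 1"
  defines "U \<equiv> simple_locus n r i j"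
    and "V \<equiv> (\<lambda>e k. if 1 \<le> k \<and> k \<le> i + 1
                     then \<i> *\<^sub>m comm (spec_proj j (psum i e)) (e k) else 0)"
    and "\<phi> \<equiv> (\<lambda>t e k. if 1 \<le> k \<and> k \<le> i + 1
                     then mexp ((\<i> * complex_of_real t) *\<^sub>m spec_proj j (psum i e)) ** e k
                          ** mexp ((- \<i> * complex_of_real t) *\<^sub>m spec_proj j (psum i e))
                     else e k)"
  shows "openin (product_topology (\<lambda>k. top_of_set (orbit (r k))) {1..n}) U \<and>
         is_hamiltonian n r U (lam i j) V \<and>
         is_flow n U V \<phi>"
proof (intro conjI)
  \<comment> \<open>Since \<open>n \<ge> 4\<close>, the natural-number subtraction in
    \<open>n - 3\<close> is not truncated.\<close>
  have i: "i + 1 \<le> n" and j: "1 \<le> j" "j \<le> CARD('d)"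
    using assms(1,3,6,7,8) by auto
  show "openin (product_topology (\<lambda>k. top_of_set (orbit (r k))) {1..n}) U"
    unfolding U_def by (rule openin_simple_locus[OF i j])
  show "is_hamiltonian n r U (lam i j) V"
    unfolding U_def V_def by (rule lam_is_hamiltonian[OF assms(4) i j])
  show "is_flow n U V \<phi>"
    unfolding U_def V_def \<phi>_def by (rule lam_is_flow[OF i])
qed

end
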